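(* Consider the Gaussian side-channel assisted three-node full-duplex network described in the context, under the per-node power constraints. If $(R_1,R_2)$ lies in the capacity region, then there exists $\lambda\in[0,1]$ (with $\bar\lambda=1-\lambda$) such that \[ R_1\le C(\mathrm{SNR}_1),\qquad R_2\le C(\bar\lambda\,\mathrm{SNR}_2), \] \[ R_1+R_2\le C\!\left(\frac{\bar\lambda\,\mathrm{SNR}_2}{1+\bar\lambda\,\mathrm{INR}}\right)+W\,C\!\left(\frac{\lambda\,\mathrm{SNR}_{\rm side}}{W}\right)+C\!\left(\mathrm{SNR}_1+\bar\lambda\,\mathrm{INR}+2\sqrt{\bar\lambda\,\mathrm{SNR}_1\,\mathrm{INR}}\right). \]
   Context: Gaussian side-channel assisted three-node full-duplex network: a full-duplex base station (BS) sends a downlink message $S_1$ at rate $R_1$ to a half-duplex mobile M2, while a half-duplex mobile M1 sends an uplink message $S_2$ at rate $R_2$ to BS; $S_1,S_2$ are independent and uniform. The main channel has bandwidth $W_m$; an orthogonal wireless side-channel from M1 to M2 has bandwidth $W_s$, and $W=W_s/W_m\in[0,W_{\max}]$. The real-valued input–output relations are $Y_1=\gamma_1X_1+\gamma^m_{21}X_2+Z_1$ (received by M2 on the main channel), $Y_2=\gamma_2X_2+Z_2$ (received by BS), $Y_3=\gamma^s_{21}X_3+Z_3$ (received by M2 on the side-channel), where $X_1$ is sent by BS, $X_2$ (main channel) and $X_3$ (side-channel) are sent by M1, and $Z_i$ are mutually independent i.i.d. $\mathcal N(0,\sigma^2)$. Power constraints: $\mathbb E|X_1|^2\le P_1$,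 $\mathbb E|X_2+X_3|^2\le P_2$. $\mathrm{SNR}_1=|\gamma_1|^2P_1/\sigma^2$, $\mathrm{SNR}_2=|\gamma_2|^2P_2/\sigma^2$, $\mathrm{INR}=|\gamma^m_{21}|^2P_2/\sigma^2$, $\mathrm{SNR}_{\rm side}=|\gamma^s_{21}|^2P_2/\sigma^2$. Rates are in bits/s, $C(x)=W_m\log_2(1+x)$, so that $W\,C(\lambda\mathrm{SNR}_{\rm side}/W)=W_s\log_2(1+\lambda\mathrm{SNR}_{\rm side}/W)$ (side-channel noise power scales with its bandwidth), with the convention $W\,C(x/W)=0$ if $W=0$. M2 decodes $S_1$ from $(Y_1^n,Y_3^n)$; BS decodes $S_2$ from $Y_2^n$ and $S_1$; BS's transmitted symbol $X_{1i}$ at time $i$ is a function of $(S_1,Y_2^{i-1})$ (causal knowledge at the full-duplex BS). The capacity region is the closure of the set of rate pairs achievable with error probability tending to zero. *)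

theory Defs
  imports "HOL-Probability.Probability"
begin

text \<open>Channel parameters: g1 = gamma_1, g2 = gamma_2, gm = gamma^m_21, gs = gamma^s_21,
  sg = noise standard deviation sigma (noise variance sg^2).
  Block of n main-channel real symbols (2 W_m symbols per second) and
  m = floor(W n) side-channel real symbols (2 W_s symbols per second) in the same time span.\<close>

definition Ccap :: "real \<Rightarrow> real \<Rightarrow> real" where
  "Ccap Wm x = Wm * log 2 (1 + x)"

definition side_term :: "real \<Rightarrow> real \<Rightarrow> real \<Rightarrow> real" where
  "side_term Wm W x = (if W = 0 then 0 else W * Ccap Wm (x / W))"

definition side_len :: "real \<Rightarrow> nat \<Rightarrow> nat" where
  "side_len W n = nat \<lfloor>W * real n\<rfloor>"

text \<open>Noise components: (0,i) = Z1_i, (1,i) = Z2_i for i < n; (2,j) = Z3_j for j < m.\<close>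
definition noise_idx :: "nat \<Rightarrow> nat \<Rightarrow> (nat \<times> nat) set" where
  "noise_idx n m = ({0,1} \<times> {..<n}) \<union> ({2} \<times> {..<m})"

definition noise :: "nat \<Rightarrow> nat \<Rightarrow> real \<Rightarrow> (nat \<times> nat \<Rightarrow> real) measure" where
  "noise n m sg = PiM (noise_idx n m) (\<lambda>_. density lborel (normal_density 0 sg))"

text \<open>Signals. f1 i s1 y = X_{1i} (BS encoder, fed with the received Y2 sequence),
  f2 s2 i = X_{2i}, f3 s2 j = X_{3j} (M1 encoders; M1 is half-duplex and receives nothing).\<close>
definition sigY2 :: "real \<Rightarrow> (nat \<Rightarrow> nat \<Rightarrow> real) \<Rightarrow> nat \<Rightarrow> nat \<Rightarrow> (nat \<times> nat \<Rightarrow> real) \<Rightarrow> nat \<Rightarrow> real" where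
  "sigY2 g2 f2 n s2 \<omega> = (\<lambda>i. if i < n then g2 * f2 s2 i + \<omega> (1, i) else 0)"

definition sigX1 :: "(nat \<Rightarrow> nat \<Rightarrow> (nat \<Rightarrow> real) \<Rightarrow> real) \<Rightarrow> real \<Rightarrow> (nat \<Rightarrow> nat \<Rightarrow> real)
    \<Rightarrow> nat \<Rightarrow> nat \<Rightarrow> nat \<Rightarrow> (nat \<times> nat \<Rightarrow> real) \<Rightarrow> nat \<Rightarrow> real" where
  "sigX1 f1 g2 f2 n s1 s2 \<omega> i = f1 i s1 (sigY2 g2 f2 n s2 \<omega>)"

definition sigY1 :: "real \<Rightarrow> real \<Rightarrow> (nat \<Rightarrow> nat \<Rightarrow> (nat \<Rightarrow> real) \<Rightarrow> real) \<Rightarrow> real \<Rightarrow> (nat \<Rightarrow> nat \<Rightarrow> real)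
    \<Rightarrow> nat \<Rightarrow> nat \<Rightarrow> nat \<Rightarrow> (nat \<times> nat \<Rightarrow> real) \<Rightarrow> nat \<Rightarrow> real" where
  "sigY1 g1 gm f1 g2 f2 n s1 s2 \<omega> = (\<lambda>i. if i < n then
      g1 * sigX1 f1 g2 f2 n s1 s2 \<omega> i + gm * f2 s2 i + \<omega> (0, i) else 0)"

definition sigY3 :: "real \<Rightarrow> (nat \<Rightarrow> nat \<Rightarrow> real) \<Rightarrow> nat \<Rightarrow> nat \<Rightarrow> (nat \<times> nat \<Rightarrow> real) \<Rightarrow> nat \<Rightarrow> real" where
  "sigY3 gs f3 m s2 \<omega> = (\<lambda>j. if j < m then gs * f3 s2 j + \<omega> (2, j) else 0)"

text \<open>Decoding error event for the message pair (s1,s2): M2 decodes S1 from (Y1^n, Y3^m)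
  via dec1; BS decodes S2 from (S1, Y2^n) via dec2.\<close>
definition err_event where
  "err_event g1 g2 gm gs sg W n f1 f2 f3 dec1 dec2 s1 s2 =
     {\<omega> \<in> space (noise n (side_len W n) sg).
        dec1 (sigY1 g1 gm f1 g2 f2 n s1 s2 \<omega>) (sigY3 gs f3 (side_len W n) s2 \<omega>) \<noteq> s1
      \<or> dec2 s1 (sigY2 g2 f2 n s2 \<omega>) \<noteq> s2}"

definition good_code ::
  "real \<Rightarrow> real \<Rightarrow> real \<Rightarrow> real \<Rightarrow> real \<Rightarrow> real \<Rightarrow> real \<Rightarrow> real \<Rightarrow> nat \<Rightarrow> nat \<Rightarrow> nat
   \<Rightarrow> (nat \<Rightarrow> nat \<Rightarrow> (nat \<Rightarrow> real) \<Rightarrow> real) \<Rightarrow> (nat \<Rightarrow> nat \<Rightarrow> real) \<Rightarrow> (nat \<Rightarrow> nat \<Rightarrow> real)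
   \<Rightarrow> ((nat \<Rightarrow> real) \<Rightarrow> (nat \<Rightarrow> real) \<Rightarrow> nat) \<Rightarrow> (nat \<Rightarrow> (nat \<Rightarrow> real) \<Rightarrow> nat) \<Rightarrow> real \<Rightarrow> bool" where
  "good_code W P1 P2 g1 g2 gm gs sg n M1 M2 f1 f2 f3 dec1 dec2 eps \<longleftrightarrow>
     0 < n \<and> 0 < M1 \<and> 0 < M2 \<and>
     (\<forall>i s y y'. (\<forall>j<i. y j = y' j) \<longrightarrow> f1 i s y = f1 i s y') \<and>
     (\<forall>s1<M1. \<forall>s2<M2. \<forall>i<n.
        (\<lambda>\<omega>. sigX1 f1 g2 f2 n s1 s2 \<omega> i) \<in> borel_measurable (noise n (side_len W n) sg)) \<and>
     (\<forall>s1<M1. \<forall>s2<M2.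
        err_event g1 g2 gm gs sg W n f1 f2 f3 dec1 dec2 s1 s2 \<in> sets (noise n (side_len W n) sg)) \<and>
     (\<Sum>s1<M1. \<Sum>s2<M2. \<integral>\<^sup>+ \<omega>. ennreal (\<Sum>i<n. (sigX1 f1 g2 f2 n s1 s2 \<omega> i)\<^sup>2)
          \<partial>noise n (side_len W n) sg)
       \<le> ennreal (real M1 * real M2 * real n * P1) \<and>
     (\<Sum>s2<M2. (\<Sum>i<n. (f2 s2 i)\<^sup>2) + (\<Sum>j<side_len W n. (f3 s2 j)\<^sup>2))
       \<le> real M2 * real n * P2 \<and>
     (\<Sum>s1<M1. \<Sum>s2<M2. measure (noise n (side_len W n) sg)
          (err_event g1 g2 gm gs sg W n f1 f2 f3 dec1 dec2 s1 s2))
       \<le> eps * real M1 * real M2"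

text \<open>Capacity region (already closed): rates in bits/s, R = 2 W_m log2 M / n.\<close>
definition capacity_region ::
  "real \<Rightarrow> real \<Rightarrow> real \<Rightarrow> real \<Rightarrow> real \<Rightarrow> real \<Rightarrow> real \<Rightarrow> real \<Rightarrow> real \<Rightarrow> (real \<times> real) set" where
  "capacity_region Wm W P1 P2 g1 g2 gm gs sg =
     {(R1, R2). 0 \<le> R1 \<and> 0 \<le> R2 \<and>
        (\<forall>eps>0. \<forall>N0. \<exists>n\<ge>N0. \<exists>M1 M2 f1 f2 f3 dec1 dec2.
           good_code W P1 P2 g1 g2 gm gs sg n M1 M2 f1 f2 f3 dec1 dec2 eps \<and>
           R1 - eps \<le> 2 * Wm * log 2 (real M1) / real n \<and>
           R2 - eps \<le> 2 * Wm * log 2 (real M2) / real n)}"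

end

theory Submission
  imports Defs
begin

text \<open>
  No differential entropy is needed: for every message pair the law of the outputs \<open>(Y1, Y2, Y3)\<close> is
  compared with a Gaussian reference law whose variances are constant along the block, so that the
  log-likelihood ratio is a quadratic form and its mean is explicit from the power constraints. Since
  the decoding regions are disjoint, a reference law that does not depend on the message to be decoded
  gives them total mass at most one, and a change of measure bounds the number of messages. Choosing one
  variance per block to match the average power replaces Jensen's inequality.

  For \<open>R1\<close> the reference is \<open>Y1 ~ N(gm X2, V)\<close> with \<open>Y2, Y3\<close> as in the channel, for \<open>R2\<close> it is
  \<open>Y2 ~ N(0, V)\<close> with \<open>Y1, Y3\<close> given \<open>Y2\<close> as in the channel. For \<open>R1 + R2\<close> both \<open>Y1\<close> and \<open>Y3\<close> are
  centred Gaussian and \<open>Y2\<^sub>i ~ N(a (Y1\<^sub>i - g1 X1\<^sub>i), V)\<close>, the linear MMSE prediction of \<open>Y2\<^sub>i\<close> by a receiver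
  that knows \<open>S1\<close>, \<open>Y1\<close> and the past of \<open>Y2\<close>; causality of the encoder makes this a probability density in
  spite of the feedback. The point \<open>1 - lam\<close> is the fraction of the power of M1 spent on the main channel.
\<close>

section \<open>Product Lebesgue measure and Gaussian densities\<close>

text \<open>The feedback is tamed by a triangular structure. For fixed messages, Y2 and Y3 are noise
  plus constants, and what is added to the noise in Y1 is a function of Y2. The map from noise to
  outputs therefore preserves Lebesgue measure and is invertible, and the noise density is the
  output density in other coordinates: no Jacobian appears, and measurability is all that is asked
  of the encoder's dependence on Y2. For \<open>R2\<close> and \<open>R1 + R2\<close> the order of
  integration matters: the received blocks on which a decision rests are held fixed while the
  others, whose reference law may still depend on the message, are integrated out. The price of the
  argument is the factor \<open>1 - eps\<close> and one \<open>ln 2\<close> per block, both harmless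
  in the limit. Two further mismatches have to be absorbed. The side-channel has only floor(W n)
  symbols, which the inequality 1 - 1/u \<le> ln u handles without error term. The power split
  belongs to a code and not to the rate pair, so a single \<open>lam\<close> is obtained only by
  compactness.\<close>

abbreviation lebesgue_prod :: "'i set \<Rightarrow> ('i \<Rightarrow> real) measure" where
  "lebesgue_prod I \<equiv> PiM I (\<lambda>_. lborel)"

interpretation leb: product_sigma_finite "\<lambda>_. lborel :: real measure"
  by unfold_locales

lemma space_lebesgue_prod: "space (lebesgue_prod I) = extensional I"
  by (simp add: space_PiM PiE_UNIV_domain) (auto simp: PiE_def)

text \<open>Boxes determine a product measure, and on a box both sides factor. With this the noise
  law becomes a density against Lebesgue measure, which shifts by a signal leave alone.\<close>

lemma PiM_density_eq:
  fixes f :: "real \<Rightarrow> real"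
  assumes I: "finite I" and [measurable]: "f \<in> borel_measurable borel"
    and f: "prob_space (density lborel f)"
  shows "PiM I (\<lambda>_. density lborel f) = density (lebesgue_prod I) (\<lambda>\<omega>. \<Prod>k\<in>I. ennreal (f (\<omega> k)))"
proof -
  interpret f: prob_space "density lborel f" by (rule f)
  interpret D: product_sigma_finite "\<lambda>_. density lborel f"
    by unfold_locales
  show ?thesis
  proof (rule D.PiM_eqI[symmetric, OF I])
    show "sets (density (lebesgue_prod I) (\<lambda>\<omega>. \<Prod>k\<in>I. ennreal (f (\<omega> k)))) = sets (PiM I (\<lambda>_. density lborel f))"
      by (simp cong: sets_PiM_cong)
    fix A assume A: "\<And>i. i \<in> I \<Longrightarrow> A i \<in> sets (density lborel f)"
    then have A': "\<And>i. i \<in> I \<Longrightarrow> A i \<in> sets borel" by simp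
    have "emeasure (density (lebesgue_prod I) (\<lambda>\<omega>. \<Prod>k\<in>I. ennreal (f (\<omega> k)))) (Pi\<^sub>E I A)
        = (\<integral>\<^sup>+ \<omega>. (\<Prod>k\<in>I. ennreal (f (\<omega> k))) * indicator (Pi\<^sub>E I A) \<omega> \<partial>lebesgue_prod I)"
      using A' I by (subst emeasure_density) (auto intro!: sets_PiM_I_finite)
    also have "\<dots> = (\<integral>\<^sup>+ \<omega>. (\<Prod>k\<in>I. ennreal (f (\<omega> k)) * indicator (A k) (\<omega> k)) \<partial>lebesgue_prod I)"
    proof (rule nn_integral_cong)
      fix \<omega> :: "'a \<Rightarrow> real" assume "\<omega> \<in> space (lebesgue_prod I)"
      then have "indicator (Pi\<^sub>E I A) \<omega> = (\<Prod>k\<in>I. indicator (A k) (\<omega> k) :: ennreal)"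
        using I by (auto simp: space_lebesgue_prod PiE_iff indicator_def split: if_splits)
      then show "(\<Prod>k\<in>I. ennreal (f (\<omega> k))) * indicator (Pi\<^sub>E I A) \<omega> = (\<Prod>k\<in>I. ennreal (f (\<omega> k)) * indicator (A k) (\<omega> k))"
        by (simp add: prod.distrib)
    qed
    also have "\<dots> = (\<Prod>k\<in>I. \<integral>\<^sup>+ x. ennreal (f x) * indicator (A k) x \<partial>lborel)"
      using A' I by (intro leb.product_nn_integral_prod) auto
    also have "\<dots> = (\<Prod>k\<in>I. emeasure (density lborel f) (A k))"
      using A' by (intro prod.cong refl) (simp add: emeasure_density)
    finally show "emeasure (density (lebesgue_prod I) (\<lambda>\<omega>. \<Prod>k\<in>I. ennreal (f (\<omega> k)))) (Pi\<^sub>E I A)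
        = (\<Prod>i\<in>I. emeasure (density lborel f) (A i))" .
  qed
qed

section \<open>Translations and triangular shifts of Lebesgue measure\<close>

lemma distr_lebesgue_prod_translate:
  assumes I: "finite I"
  shows "distr (lebesgue_prod I) (lebesgue_prod I) (\<lambda>\<omega>. \<lambda>k\<in>I. \<omega> k + c k) = lebesgue_prod I"
proof (rule leb.PiM_eqI[OF I])
  fix A :: "'a \<Rightarrow> real set" assume A: "\<And>i. i \<in> I \<Longrightarrow> A i \<in> sets lborel"
  have m: "(\<lambda>\<omega>. \<lambda>k\<in>I. \<omega> k + c k) \<in> lebesgue_prod I \<rightarrow>\<^sub>M lebesgue_prod I"
    by (rule measurable_restrict) simp
  have m': "(+) (c i) -` A i \<in> sets lborel" if "i \<in> I" for i
    using measurable_sets_borel[of "(+) (c i)" borel "A i"] A[OF that] by simp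
  have "(\<lambda>\<omega>. \<lambda>k\<in>I. \<omega> k + c k) -` Pi\<^sub>E I A \<inter> space (lebesgue_prod I) = Pi\<^sub>E I (\<lambda>i. (+) (c i) -` A i)"
    by (auto simp: space_lebesgue_prod PiE_iff extensional_def add.commute)
  then have "emeasure (distr (lebesgue_prod I) (lebesgue_prod I) (\<lambda>\<omega>. \<lambda>k\<in>I. \<omega> k + c k)) (Pi\<^sub>E I A)
      = emeasure (lebesgue_prod I) (Pi\<^sub>E I (\<lambda>i. (+) (c i) -` A i))"
    using A I m by (subst emeasure_distr) (auto intro!: sets_PiM_I_finite)
  also have "\<dots> = (\<Prod>i\<in>I. emeasure lborel ((+) (c i) -` A i))"
    using I m' by (subst leb.emeasure_PiM) auto
  also have "\<dots> = (\<Prod>i\<in>I. emeasure lborel (A i))"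
  proof (rule prod.cong[OF refl])
    fix i assume "i \<in> I"
    have "emeasure lborel (A i) = emeasure (distr lborel borel ((+) (c i))) (A i)"
      by (simp add: lborel_distr_plus)
    also have "\<dots> = emeasure lborel ((+) (c i) -` A i)"
      using A[OF \<open>i \<in> I\<close>] by (subst emeasure_distr) auto
    finally show "emeasure lborel ((+) (c i) -` A i) = emeasure lborel (A i)" by simp
  qed
  finally show "emeasure (distr (lebesgue_prod I) (lebesgue_prod I) (\<lambda>\<omega>. \<lambda>k\<in>I. \<omega> k + c k)) (Pi\<^sub>E I A)
      = (\<Prod>i\<in>I. emeasure lborel (A i))" .
qed simp

lemma nn_integral_lebesgue_prod_translate:
  assumes I: "finite I" and [measurable]: "h \<in> borel_measurable (lebesgue_prod I)"
  shows "(\<integral>\<^sup>+ \<omega>. h (\<lambda>k\<in>I. \<omega> k + c k) \<partial>lebesgue_prod I) = (\<integral>\<^sup>+ \<omega>. h \<omega> \<partial>lebesgue_prod I)"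
proof -
  have m: "(\<lambda>\<omega>. \<lambda>k\<in>I. \<omega> k + c k) \<in> lebesgue_prod I \<rightarrow>\<^sub>M lebesgue_prod I"
    by (rule measurable_restrict) simp
  have "(\<integral>\<^sup>+ \<omega>. h \<omega> \<partial>distr (lebesgue_prod I) (lebesgue_prod I) (\<lambda>\<omega>. \<lambda>k\<in>I. \<omega> k + c k))
     = (\<integral>\<^sup>+ \<omega>. h (\<lambda>k\<in>I. \<omega> k + c k) \<partial>lebesgue_prod I)"
    by (rule nn_integral_distr[OF m]) simp
  then show ?thesis by (simp add: distr_lebesgue_prod_translate[OF I])
qed

lemma measurable_merge_section:
  assumes "h \<in> borel_measurable (lebesgue_prod (I \<union> J))" "x \<in> space (lebesgue_prod I)"
  shows "(\<lambda>y. h (merge I J (x, y))) \<in> borel_measurable (lebesgue_prod J)"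
proof -
  have "(\<lambda>y. merge I J (x, y)) \<in> lebesgue_prod J \<rightarrow>\<^sub>M lebesgue_prod (I \<union> J)"
    using measurable_comp[OF measurable_Pair1'[OF assms(2)] measurable_merge] by (simp add: comp_def)
  from measurable_comp[OF this assms(1)] show ?thesis by (simp add: comp_def)
qed

lemma measurable_nn_integral_merge:
  assumes "finite J" and [measurable]: "h \<in> borel_measurable (lebesgue_prod (I \<union> J))"
  shows "(\<lambda>x. \<integral>\<^sup>+ y. h (merge I J (x, y)) \<partial>lebesgue_prod J) \<in> borel_measurable (lebesgue_prod I)"
proof -
  interpret J: finite_product_sigma_finite "\<lambda>_. lborel" J
    by standard fact
  have "(\<lambda>p. h (merge I J p)) \<in> borel_measurable (lebesgue_prod I \<Otimes>\<^sub>M lebesgue_prod J)"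
    by measurable
  then have "case_prod (\<lambda>x y. h (merge I J (x, y))) \<in> borel_measurable (lebesgue_prod I \<Otimes>\<^sub>M lebesgue_prod J)"
    by (simp only: case_prod_unfold prod.collapse)
  from J.borel_measurable_nn_integral[OF this] show ?thesis .
qed

text \<open>Fubini with \<open>J\<close> innermost: once the \<open>I\<close> coordinates are fixed
  the shift on \<open>J\<close> is a constant vector, and the shift on \<open>I\<close> is constant
  throughout, so translation invariance applies twice. It is the change of variables for a map of
  unit Jacobian, with measurability of the composite in place of smoothness.\<close>

lemma nn_integral_triangular_shift:
  fixes c :: "('i \<Rightarrow> real) \<Rightarrow> 'i \<Rightarrow> real"
  assumes IJ: "finite I" "finite J" "I \<inter> J = {}"
    and h: "h \<in> borel_measurable (lebesgue_prod (I \<union> J))"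
    and hc: "(\<lambda>\<omega>. h (\<lambda>k\<in>I\<union>J. \<omega> k + c \<omega> k)) \<in> borel_measurable (lebesgue_prod (I \<union> J))"
    and cI: "\<And>\<omega> k. k \<in> I \<Longrightarrow> c \<omega> k = d k"
    and cJ: "\<And>\<omega> \<omega>' k. k \<in> J \<Longrightarrow> (\<And>i. i \<in> I \<Longrightarrow> \<omega> i = \<omega>' i) \<Longrightarrow> c \<omega> k = c \<omega>' k"
  shows "(\<integral>\<^sup>+ \<omega>. h (\<lambda>k\<in>I\<union>J. \<omega> k + c \<omega> k) \<partial>lebesgue_prod (I \<union> J)) = (\<integral>\<^sup>+ y. h y \<partial>lebesgue_prod (I \<union> J))"
proof -
  define K where "K x = (\<integral>\<^sup>+ y. h (merge I J (x, y)) \<partial>lebesgue_prod J)" for x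
  have mK: "K \<in> borel_measurable (lebesgue_prod I)"
    unfolding K_def by (rule measurable_nn_integral_merge[OF IJ(2) h])
  have "(\<integral>\<^sup>+ \<omega>. h (\<lambda>k\<in>I\<union>J. \<omega> k + c \<omega> k) \<partial>lebesgue_prod (I \<union> J))
      = (\<integral>\<^sup>+ x. \<integral>\<^sup>+ y. h (\<lambda>k\<in>I\<union>J. merge I J (x, y) k + c (merge I J (x, y)) k) \<partial>lebesgue_prod J \<partial>lebesgue_prod I)"
    using leb.product_nn_integral_fold[OF IJ(3) IJ(1,2) hc] .
  also have "\<dots> = (\<integral>\<^sup>+ x. K (\<lambda>k\<in>I. x k + d k) \<partial>lebesgue_prod I)"
  proof (rule nn_integral_cong)
    fix x assume x: "x \<in> space (lebesgue_prod I)"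
    \<comment> \<open>\<open>c x\<close> can stand for the shift at every merged point: on
      \<open>J\<close> it reads only coordinates in \<open>I\<close>, where merging keeps
      \<open>x\<close>.\<close>
    let ?x = "\<lambda>k\<in>I. x k + d k" and ?c = "c x"
    have "(\<lambda>k\<in>I\<union>J. merge I J (x, y) k + c (merge I J (x, y)) k) = merge I J (?x, \<lambda>k\<in>J. y k + ?c k)" for y
    proof
      fix k
      consider "k \<in> I" "k \<notin> J" | "k \<in> J" "k \<notin> I" | "k \<notin> I" "k \<notin> J"
        using IJ(3) by blast
      then show "(\<lambda>k\<in>I\<union>J. merge I J (x, y) k + c (merge I J (x, y)) k) k = merge I J (?x, \<lambda>k\<in>J. y k + ?c k) k"
      proof cases
        case 1
        then show ?thesis by (simp add: cI merge_def)
      next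
        case 2
        have "c (merge I J (x, y)) k = c x k"
          using IJ(3) by (intro cJ[OF 2(1)]) (auto simp: merge_def)
        with 2 show ?thesis by (simp add: merge_def)
      next
        case 3
        then show ?thesis by (simp add: merge_def)
      qed
    qed
    then have "(\<integral>\<^sup>+ y. h (\<lambda>k\<in>I\<union>J. merge I J (x, y) k + c (merge I J (x, y)) k) \<partial>lebesgue_prod J)
        = (\<integral>\<^sup>+ y. h (merge I J (?x, \<lambda>k\<in>J. y k + ?c k)) \<partial>lebesgue_prod J)" by simp
    also have "\<dots> = K ?x"
      unfolding K_def
      by (rule nn_integral_lebesgue_prod_translate[OF IJ(2) measurable_merge_section[OF h]])
         (simp add: space_lebesgue_prod)
    finally show "(\<integral>\<^sup>+ y. h (\<lambda>k\<in>I\<union>J. merge I J (x, y) k + c (merge I J (x, y)) k) \<partial>lebesgue_prod J) = K ?x" .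
  qed
  also have "\<dots> = (\<integral>\<^sup>+ x. K x \<partial>lebesgue_prod I)"
    by (rule nn_integral_lebesgue_prod_translate[OF IJ(1) mK])
  also have "\<dots> = (\<integral>\<^sup>+ y. h y \<partial>lebesgue_prod (I \<union> J))"
    unfolding K_def using leb.product_nn_integral_fold[OF IJ(3) IJ(1,2) h, symmetric] .
  finally show ?thesis .
qed

section \<open>Gaussian densities with fixed and with causal means\<close>

lemma nn_integral_normal_density:
  "0 < v \<Longrightarrow> (\<integral>\<^sup>+ x. ennreal (normal_density m v x) \<partial>lborel) = 1"
  by (subst nn_integral_eq_integral) auto

lemma nn_integral_prod_normal_density:
  assumes "finite I" "\<And>k. k \<in> I \<Longrightarrow> 0 < v k"
  shows "(\<integral>\<^sup>+ y. (\<Prod>k\<in>I. ennreal (normal_density (m k) (v k) (y k))) \<partial>lebesgue_prod I) = 1"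
  using assms by (subst leb.product_nn_integral_prod) (auto simp: nn_integral_normal_density)

text \<open>The exponent is minus the logarithm of the ratio of the noise density at
  \<open>w\<close> to the reference density at \<open>y\<close>; this is one coordinate of the
  log-likelihood ratio.\<close>

lemma normal_density_ratio:
  assumes "0 < v" "0 < sg"
  shows "normal_density 0 sg w * exp (- (ln (v / sg) + (y - a)\<^sup>2 / (2 * v\<^sup>2) - w\<^sup>2 / (2 * sg\<^sup>2))) = normal_density a v y"
proof -
  have "exp (- (ln (v / sg) + (y - a)\<^sup>2 / (2 * v\<^sup>2) - w\<^sup>2 / (2 * sg\<^sup>2)))
      = exp (- ln (v / sg)) * exp (- ((y - a)\<^sup>2 / (2 * v\<^sup>2))) * exp (w\<^sup>2 / (2 * sg\<^sup>2))"
    by (simp add: mult_exp_exp)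
  also have "exp (- ln (v / sg)) = sg / v"
    using assms by (simp add: exp_minus)
  finally show ?thesis
    using assms by (simp add: normal_density_def real_sqrt_mult exp_minus field_simps)
qed

text \<open>The latest coordinate is integrated out before the others: by \<open>causal\<close>
  neither the earlier factors nor its own mean involve it, so it contributes a Gaussian integral
  equal to 1. The injection \<open>e\<close> places the time indices inside a larger index
  type.\<close>

lemma nn_integral_causal_normal_density:
  fixes e :: "nat \<Rightarrow> 'i" and m :: "nat \<Rightarrow> ('i \<Rightarrow> real) \<Rightarrow> real"
  assumes e: "inj e" and v: "0 < v"
    and m: "\<And>i. i < n \<Longrightarrow> m i \<in> borel_measurable (lebesgue_prod (e ` {..<n}))"
    and causal: "\<And>i y y'. i < n \<Longrightarrow> (\<And>j. j < i \<Longrightarrow> y (e j) = y' (e j)) \<Longrightarrow> m i y = m i y'"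
  shows "(\<integral>\<^sup>+ y. (\<Prod>i<n. ennreal (normal_density (m i y) v (y (e i)))) \<partial>lebesgue_prod (e ` {..<n})) = 1"
  using m causal
proof (induction n)
  case 0
  have "(\<integral>\<^sup>+ y. 1 \<partial>lebesgue_prod ({} :: 'i set)) = 1"
    by (subst leb.nn_integral_empty) auto
  then show ?case by simp
next
  case (Suc n)
  let ?J = "e ` {..<n}"
  have ins: "e ` {..<Suc n} = insert (e n) ?J" by (auto simp: lessThan_Suc)
  have nin: "e n \<notin> ?J" using e by (auto dest: injD)
  \<comment> \<open>Measurability is only known on the larger product. Overwriting the last
    coordinate by 0 maps the smaller product into it, and causality makes the overwriting invisible
    to \<open>m i\<close>.\<close>
  have m': "m i \<in> borel_measurable (lebesgue_prod ?J)" if "i < Suc n" for i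
  proof -
    have "(\<lambda>y. y(e n := 0)) \<in> lebesgue_prod ?J \<rightarrow>\<^sub>M lebesgue_prod (insert (e n) ?J)"
      by (rule measurable_fun_upd[where J="?J"]) auto
    from measurable_comp[OF this] Suc.prems(1)[OF that]
    have "(\<lambda>y. m i (y(e n := 0))) \<in> borel_measurable (lebesgue_prod ?J)"
      by (simp add: ins comp_def)
    moreover have "m i (y(e n := 0)) = m i y" for y
      using that e by (intro Suc.prems(2)) (auto dest: injD)
    ultimately show ?thesis by simp
  qed
  have ind: "(\<integral>\<^sup>+ y. (\<Prod>i<n. ennreal (normal_density (m i y) v (y (e i)))) \<partial>lebesgue_prod ?J) = 1"
    using m' by (intro Suc.IH) (auto intro: Suc.prems(2))
  have upd: "m i (y(e n := z)) = m i y" if "i < Suc n" for i y z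
    using that e by (intro Suc.prems(2)) (auto dest: injD)
  have meas: "(\<lambda>y. \<Prod>i<Suc n. ennreal (normal_density (m i y) v (y (e i)))) \<in> borel_measurable (lebesgue_prod (insert (e n) ?J))"
  proof (rule borel_measurable_prod_ennreal)
    fix i assume i: "i \<in> {..<Suc n}"
    have [measurable]: "m i \<in> borel_measurable (lebesgue_prod (insert (e n) ?J))"
      using Suc.prems(1)[of i] i by (simp add: ins)
    have [measurable]: "(\<lambda>y. y (e i)) \<in> borel_measurable (lebesgue_prod (insert (e n) ?J))"
      using measurable_component_singleton[of "e i" "insert (e n) ?J" "\<lambda>_. lborel :: real measure"] i
      by (simp add: ins[symmetric])
    show "(\<lambda>y. ennreal (normal_density (m i y) v (y (e i)))) \<in> borel_measurable (lebesgue_prod (insert (e n) ?J))"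
      unfolding normal_density_def by measurable
  qed
  have "(\<integral>\<^sup>+ y. (\<Prod>i<Suc n. ennreal (normal_density (m i y) v (y (e i)))) \<partial>lebesgue_prod (insert (e n) ?J))
     = (\<integral>\<^sup>+ y. \<integral>\<^sup>+ z. (\<Prod>i<Suc n. ennreal (normal_density (m i (y(e n := z))) v ((y(e n := z)) (e i)))) \<partial>lborel \<partial>lebesgue_prod ?J)"
    using leb.product_nn_integral_insert[OF _ nin meas] by simp
  also have "\<dots> = (\<integral>\<^sup>+ y. \<integral>\<^sup>+ z. (\<Prod>i<n. ennreal (normal_density (m i y) v (y (e i)))) * ennreal (normal_density (m n y) v z) \<partial>lborel \<partial>lebesgue_prod ?J)"
    using e by (intro nn_integral_cong) (auto simp: upd mult.commute dest: injD intro!: arg_cong2[where f="(*)"] prod.cong)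
  also have "\<dots> = (\<integral>\<^sup>+ y. (\<Prod>i<n. ennreal (normal_density (m i y) v (y (e i)))) \<partial>lebesgue_prod ?J)"
    using v by (simp add: nn_integral_cmult nn_integral_normal_density)
  finally show ?case by (simp add: ind ins)
qed

text \<open>Serves to bound the sum over messages while the \<open>I\<close> coordinates are held
  fixed: a decoder that reads only these has then already decided.\<close>

lemma sum_nn_integral_fold_le:
  fixes h :: "'s \<Rightarrow> ('i \<Rightarrow> real) \<Rightarrow> ennreal"
  assumes IJ: "finite I" "finite J" "I \<inter> J = {}"
    and h: "\<And>s. s \<in> S \<Longrightarrow> h s \<in> borel_measurable (lebesgue_prod (I \<union> J))"
    and le: "\<And>x. x \<in> space (lebesgue_prod I) \<Longrightarrow> (\<Sum>s\<in>S. \<integral>\<^sup>+ y. h s (merge I J (x, y)) \<partial>lebesgue_prod J) \<le> H x"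
  shows "(\<Sum>s\<in>S. \<integral>\<^sup>+ y. h s y \<partial>lebesgue_prod (I \<union> J)) \<le> (\<integral>\<^sup>+ x. H x \<partial>lebesgue_prod I)"
proof -
  have "(\<Sum>s\<in>S. \<integral>\<^sup>+ y. h s y \<partial>lebesgue_prod (I \<union> J))
      = (\<Sum>s\<in>S. \<integral>\<^sup>+ x. \<integral>\<^sup>+ y. h s (merge I J (x, y)) \<partial>lebesgue_prod J \<partial>lebesgue_prod I)"
    by (intro sum.cong refl leb.product_nn_integral_fold[OF IJ(3,1,2)] h)
  also have "\<dots> = (\<integral>\<^sup>+ x. (\<Sum>s\<in>S. \<integral>\<^sup>+ y. h s (merge I J (x, y)) \<partial>lebesgue_prod J) \<partial>lebesgue_prod I)"
    by (intro nn_integral_sum[symmetric] measurable_nn_integral_merge IJ(2) h)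
  also have "\<dots> \<le> (\<integral>\<^sup>+ x. H x \<partial>lebesgue_prod I)"
    by (intro nn_integral_mono le)
  finally show ?thesis .
qed

text \<open>Disjointness of decoding regions: \<open>d\<close> is the decision taken at the point
  \<open>y\<close>, and only its region can contain \<open>y\<close>.\<close>

lemma sum_indicator_le_one:
  assumes "finite S" "\<And>s. s \<in> S \<Longrightarrow> y \<in> A s \<Longrightarrow> s = d"
  shows "(\<Sum>s\<in>S. indicator (A s) y) \<le> (1 :: ennreal)"
proof -
  have "(\<Sum>s\<in>S. indicator (A s) y) \<le> (\<Sum>s\<in>S. if s = d then 1 else (0 :: ennreal))"
    using assms(2) by (intro sum_mono) (auto simp: indicator_def)
  also have "\<dots> \<le> 1" using assms(1) by (simp add: sum.delta)
  finally show ?thesis .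
qed

text \<open>The inequality \<open>ln x \<le> x - 1\<close> at \<open>x = K powr indicator (A s) * exp (- l s) / 2\<close> plays the role of
  both Fano's inequality and data processing for the relative entropy \<open>expectation (l s)\<close>.\<close>

lemma (in prob_space) change_of_measure_converse:
  fixes l :: "'s \<Rightarrow> 'a \<Rightarrow> real" and K :: real
  assumes S: "finite S" and K: "1 \<le> K"
    and A: "\<And>s. s \<in> S \<Longrightarrow> A s \<in> events"
    and l: "\<And>s. s \<in> S \<Longrightarrow> integrable M (l s)"
    and mass: "\<And>s. s \<in> S \<Longrightarrow> (\<integral>\<^sup>+ \<omega>. ennreal (exp (- l s \<omega>)) \<partial>M) \<le> 1"
    and dec: "(\<Sum>s\<in>S. \<integral>\<^sup>+ \<omega>. ennreal (exp (- l s \<omega>)) * indicator (A s) \<omega> \<partial>M) \<le> ennreal (card S / K)"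
  shows "(\<Sum>s\<in>S. prob (A s)) * ln K \<le> (\<Sum>s\<in>S. expectation (l s)) + card S * ln 2"
proof -
  have [measurable]: "l s \<in> borel_measurable M" "A s \<in> events" if "s \<in> S" for s
    using l[OF that] A[OF that] by auto
  have ie: "integrable M (\<lambda>\<omega>. exp (- l s \<omega>))" and e1: "expectation (\<lambda>\<omega>. exp (- l s \<omega>)) \<le> 1" if "s \<in> S" for s
  proof -
    show i: "integrable M (\<lambda>\<omega>. exp (- l s \<omega>))"
      using that mass[OF that] by (intro integrableI_bounded) (auto intro: le_less_trans simp: ennreal_one_less_top)
    have "ennreal (expectation (\<lambda>\<omega>. exp (- l s \<omega>))) \<le> 1"
      using mass[OF that] i by (simp add: nn_integral_eq_integral)
    then show "expectation (\<lambda>\<omega>. exp (- l s \<omega>)) \<le> 1" by simp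
  qed
  have iA: "integrable M (\<lambda>\<omega>. exp (- l s \<omega>) * indicator (A s) \<omega>)" if "s \<in> S" for s
    using integrable_real_mult_indicator[OF A[OF that] ie[OF that]] by (simp add: mult.commute)
  have dec': "(\<Sum>s\<in>S. expectation (\<lambda>\<omega>. exp (- l s \<omega>) * indicator (A s) \<omega>)) \<le> card S / K"
  proof -
    have "ennreal (\<Sum>s\<in>S. expectation (\<lambda>\<omega>. exp (- l s \<omega>) * indicator (A s) \<omega>))
       = (\<Sum>s\<in>S. ennreal (expectation (\<lambda>\<omega>. exp (- l s \<omega>) * indicator (A s) \<omega>)))"
      by (rule sum_ennreal[symmetric]) simp
    also have "\<dots> = (\<Sum>s\<in>S. \<integral>\<^sup>+ \<omega>. ennreal (exp (- l s \<omega>)) * indicator (A s) \<omega> \<partial>M)"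
    proof (rule sum.cong[OF refl])
      fix s assume "s \<in> S"
      have "(\<integral>\<^sup>+ \<omega>. ennreal (exp (- l s \<omega>)) * indicator (A s) \<omega> \<partial>M) = (\<integral>\<^sup>+ \<omega>. ennreal (exp (- l s \<omega>) * indicator (A s) \<omega>) \<partial>M)"
        by (intro nn_integral_cong) (simp add: indicator_def)
      then show "ennreal (expectation (\<lambda>\<omega>. exp (- l s \<omega>) * indicator (A s) \<omega>)) = (\<integral>\<^sup>+ \<omega>. ennreal (exp (- l s \<omega>)) * indicator (A s) \<omega> \<partial>M)"
        using iA[OF \<open>s \<in> S\<close>] by (simp add: nn_integral_eq_integral)
    qed
    finally have "ennreal (\<Sum>s\<in>S. expectation (\<lambda>\<omega>. exp (- l s \<omega>) * indicator (A s) \<omega>)) \<le> ennreal (card S / K)"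
      using dec by simp
    then show ?thesis using K by (subst (asm) ennreal_le_iff) auto
  qed
  \<comment> \<open>On \<open>A s\<close> the factor K is below 1 + K, elsewhere it is 1. The bound
    thus splits into the total mass and K times the decoding mass, the two quantities that the
    hypotheses control.\<close>
  have pt: "ln K * indicator (A s) \<omega> - ln 2 - l s \<omega> \<le> (exp (- l s \<omega>) + K * (exp (- l s \<omega>) * indicator (A s) \<omega>)) / 2 - 1" for s \<omega>
  proof -
    let ?x = "exp (ln K * indicator (A s) \<omega> - ln 2 - l s \<omega>)"
    have "ln ?x \<le> ?x - 1" by (rule ln_le_minus_one) simp
    moreover have "?x = exp (ln K * indicator (A s) \<omega>) * exp (- l s \<omega>) / 2"
      by (simp add: exp_diff exp_add exp_minus field_simps)
    moreover have "exp (ln K * indicator (A s) \<omega>) \<le> 1 + K * indicator (A s) \<omega>"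
      using K by (auto simp: indicator_def)
    then have "exp (ln K * indicator (A s) \<omega>) * exp (- l s \<omega>) \<le> (1 + K * indicator (A s) \<omega>) * exp (- l s \<omega>)"
      by (rule mult_right_mono) simp
    ultimately show ?thesis by (simp add: algebra_simps)
  qed
  have "ln K * prob (A s) - ln 2 - expectation (l s)
      \<le> (1 + K * expectation (\<lambda>\<omega>. exp (- l s \<omega>) * indicator (A s) \<omega>)) / 2 - 1" if "s \<in> S" for s
  proof -
    note int = A[OF that] l[OF that] ie[OF that] iA[OF that]
    have i1: "integrable M (\<lambda>\<omega>. ln K * indicator (A s) \<omega>)"
      using int by (intro integrable_mult_right integrable_real_indicator) (auto simp: less_top[symmetric])
    have i2: "integrable M (\<lambda>\<omega>. K * (exp (- l s \<omega>) * indicator (A s) \<omega>))"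
      by (intro integrable_mult_right int)
    have "expectation (\<lambda>\<omega>. ln K * indicator (A s) \<omega> - ln 2 - l s \<omega>)
        = expectation (\<lambda>\<omega>. ln K * indicator (A s) \<omega> - ln 2) - expectation (l s)"
      by (intro Bochner_Integration.integral_diff Bochner_Integration.integrable_diff i1 int integrable_const)
    also have "expectation (\<lambda>\<omega>. ln K * indicator (A s) \<omega> - ln 2) = expectation (\<lambda>\<omega>. ln K * indicator (A s) \<omega>) - ln 2"
      by (subst Bochner_Integration.integral_diff[OF i1 integrable_const]) (simp add: prob_space)
    also have "expectation (\<lambda>\<omega>. ln K * indicator (A s) \<omega>) = ln K * prob (A s)"
      using A[OF that] sets.sets_into_space[OF A[OF that]] by (simp add: Int_absorb2)
    finally have "ln K * prob (A s) - ln 2 - expectation (l s) = expectation (\<lambda>\<omega>. ln K * indicator (A s) \<omega> - ln 2 - l s \<omega>)"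
      by simp
    also have "\<dots> \<le> expectation (\<lambda>\<omega>. (exp (- l s \<omega>) + K * (exp (- l s \<omega>) * indicator (A s) \<omega>)) / 2 - 1)"
      by (intro integral_mono Bochner_Integration.integrable_diff Bochner_Integration.integrable_add
          integrable_divide_zero i1 i2 int integrable_const pt impI)
    also have "\<dots> = expectation (\<lambda>\<omega>. (exp (- l s \<omega>) + K * (exp (- l s \<omega>) * indicator (A s) \<omega>)) / 2) - 1"
      by (subst Bochner_Integration.integral_diff)
         (auto intro!: Bochner_Integration.integrable_add integrable_divide_zero i2 int simp: prob_space simp del: integrable_mult_right_iff)
    also have "expectation (\<lambda>\<omega>. (exp (- l s \<omega>) + K * (exp (- l s \<omega>) * indicator (A s) \<omega>)) / 2)
        = (expectation (\<lambda>\<omega>. exp (- l s \<omega>)) + expectation (\<lambda>\<omega>. K * (exp (- l s \<omega>) * indicator (A s) \<omega>))) / 2"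
      by (subst integral_divide_zero, subst Bochner_Integration.integral_add[OF int(3) i2]) simp
    finally have "ln K * prob (A s) - ln 2 - expectation (l s)
        \<le> (expectation (\<lambda>\<omega>. exp (- l s \<omega>)) + K * expectation (\<lambda>\<omega>. exp (- l s \<omega>) * indicator (A s) \<omega>)) / 2 - 1"
      by simp
    with e1[OF that] show ?thesis by argo
  qed
  then have "(\<Sum>s\<in>S. ln K * prob (A s) - ln 2 - expectation (l s))
     \<le> (\<Sum>s\<in>S. (1 + K * expectation (\<lambda>\<omega>. exp (- l s \<omega>) * indicator (A s) \<omega>)) / 2 - 1)"
    by (rule sum_mono)
  also have "\<dots> = (K * (\<Sum>s\<in>S. expectation (\<lambda>\<omega>. exp (- l s \<omega>) * indicator (A s) \<omega>)) - card S) / 2"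
    by (simp add: sum_subtractf sum.distrib sum_divide_distrib[symmetric] sum_distrib_left[symmetric] field_simps)
  \<comment> \<open>Total mass and K times decoding mass add up to at most \<open>card S\<close>
    each, so their half sum cancels the subtracted ones. This explains the division by 2, paid for
    by the term \<open>ln 2\<close>.\<close>
  also have "\<dots> \<le> 0"
    using dec' K by (simp add: field_simps)
  finally show ?thesis
    by (simp add: sum_subtractf sum_distrib_left[symmetric] mult.commute)
qed

section \<open>Codes\<close>

text \<open>Structure and measurability of a code only. Power and error constraints are added later,
  once the power of M1 has been divided between its two channels.\<close>

locale network_code =
  fixes W g1 g2 gm gs sg :: real and n M1 M2 :: nat
    and f1 :: "nat \<Rightarrow> nat \<Rightarrow> (nat \<Rightarrow> real) \<Rightarrow> real" and f2 f3 :: "nat \<Rightarrow> nat \<Rightarrow> real"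
    and dec1 :: "(nat \<Rightarrow> real) \<Rightarrow> (nat \<Rightarrow> real) \<Rightarrow> nat" and dec2 :: "nat \<Rightarrow> (nat \<Rightarrow> real) \<Rightarrow> nat"
  assumes sg: "0 < sg" and M1: "0 < M1" and M2: "0 < M2"
    and causal: "\<And>i s y y'. (\<And>j. j < i \<Longrightarrow> y j = y' j) \<Longrightarrow> f1 i s y = f1 i s y'"
    and measurable_X1: "\<And>s1 s2 i. s1 < M1 \<Longrightarrow> s2 < M2 \<Longrightarrow> i < n \<Longrightarrow>
        (\<lambda>\<omega>. sigX1 f1 g2 f2 n s1 s2 \<omega> i) \<in> borel_measurable (noise n (side_len W n) sg)"
    and sets_err: "\<And>s1 s2. s1 < M1 \<Longrightarrow> s2 < M2 \<Longrightarrow>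
        err_event g1 g2 gm gs sg W n f1 f2 f3 dec1 dec2 s1 s2 \<in> sets (noise n (side_len W n) sg)"
begin

abbreviation m :: nat where "m \<equiv> side_len W n"
abbreviation idx :: "(nat \<times> nat) set" where "idx \<equiv> noise_idx n m"
abbreviation N :: "(nat \<times> nat \<Rightarrow> real) measure" where "N \<equiv> noise n m sg"
abbreviation block :: "nat \<Rightarrow> nat \<Rightarrow> (nat \<times> nat) set" where "block c l \<equiv> {c} \<times> {..<l}"

text \<open>The padding by 0 is the one used in the signal definitions, so that encoder and decoders
  are fed literally the same sequences.\<close>

definition rx :: "nat \<Rightarrow> nat \<Rightarrow> (nat \<times> nat \<Rightarrow> real) \<Rightarrow> nat \<Rightarrow> real" where
  "rx c l y = (\<lambda>i. if i < l then y (c, i) else 0)"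

text \<open>The feedback sequence \<open>z\<close> is a separate argument because it is read off the
  noise in \<open>out\<close> and off the outputs in \<open>inp\<close>.\<close>

definition mean :: "nat \<Rightarrow> nat \<Rightarrow> (nat \<Rightarrow> real) \<Rightarrow> nat \<times> nat \<Rightarrow> real" where
  "mean s1 s2 z k = (if fst k = 0 then g1 * f1 (snd k) s1 z + gm * f2 s2 (snd k)
     else if fst k = 1 then g2 * f2 s2 (snd k) else gs * f3 s2 (snd k))"

definition out :: "nat \<Rightarrow> nat \<Rightarrow> (nat \<times> nat \<Rightarrow> real) \<Rightarrow> nat \<times> nat \<Rightarrow> real" where
  "out s1 s2 \<omega> = (\<lambda>k\<in>idx. \<omega> k + mean s1 s2 (sigY2 g2 f2 n s2 \<omega>) k)"

text \<open>Right inverse of \<open>out\<close> on output vectors. It exists despite the feedback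
  because the sequence Y2 that the encoder saw is itself part of the output vector.\<close>

definition inp :: "nat \<Rightarrow> nat \<Rightarrow> (nat \<times> nat \<Rightarrow> real) \<Rightarrow> nat \<times> nat \<Rightarrow> real" where
  "inp s1 s2 y = (\<lambda>k\<in>idx. y k - mean s1 s2 (rx 1 n y) k)"

text \<open>The complement of the error event, moved from the noise space to the output space: only
  there do the sets for different messages become disjoint decision regions.\<close>

definition correct :: "nat \<Rightarrow> nat \<Rightarrow> (nat \<times> nat \<Rightarrow> real) set" where
  "correct s1 s2 = {y \<in> space (lebesgue_prod idx). dec1 (rx 0 n y) (rx 2 m y) = s1 \<and> dec2 s1 (rx 1 n y) = s2}"

lemma idx_iff:
  "(c, i) \<in> idx \<longleftrightarrow> (c = 0 \<or> c = 1) \<and> i < n \<or> c = 2 \<and> i < m"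
  by (auto simp: noise_idx_def)

lemma idx_split: "idx = block 0 n \<union> block 1 n \<union> block 2 m"
  by (auto simp: noise_idx_def)

lemma finite_idx [simp]: "finite idx"
  by (simp add: noise_idx_def)

lemma sets_N: "sets N = sets (lebesgue_prod idx)"
  unfolding noise_def by (rule sets_PiM_cong) auto

lemma space_N: "space N = extensional idx"
  using sets_eq_imp_space_eq[OF sets_N] by (simp add: space_lebesgue_prod)

lemma measurable_N_iff: "borel_measurable N = borel_measurable (lebesgue_prod idx)"
  by (rule measurable_cong_sets[OF sets_N refl])

lemma prob_space_N: "prob_space N"
  unfolding noise_def by (intro prob_space_PiM prob_space_normal_density sg)

lemma N_density: "N = density (lebesgue_prod idx) (\<lambda>\<omega>. \<Prod>k\<in>idx. ennreal (normal_density 0 sg (\<omega> k)))"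
  unfolding noise_def by (intro PiM_density_eq prob_space_normal_density sg) auto

lemma sigY2_cong: "(\<And>i. i < n \<Longrightarrow> \<omega> (1, i) = \<omega>' (1, i)) \<Longrightarrow> sigY2 g2 f2 n s2 \<omega> = sigY2 g2 f2 n s2 \<omega>'"
  by (auto simp: sigY2_def)

lemma rx_out:
  "rx 1 n (out s1 s2 \<omega>) = sigY2 g2 f2 n s2 \<omega>"
  "rx 0 n (out s1 s2 \<omega>) = sigY1 g1 gm f1 g2 f2 n s1 s2 \<omega>"
  "rx 2 m (out s1 s2 \<omega>) = sigY3 gs f3 m s2 \<omega>"
  by (auto simp: rx_def out_def idx_iff mean_def sigY1_def sigY2_def sigY3_def sigX1_def)

lemma out_inp: "y \<in> extensional idx \<Longrightarrow> out s1 s2 (inp s1 s2 y) = y"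
proof -
  assume y: "y \<in> extensional idx"
  have "sigY2 g2 f2 n s2 (inp s1 s2 y) = rx 1 n y"
    by (auto simp: sigY2_def rx_def inp_def idx_iff mean_def)
  with y show ?thesis by (auto simp: out_def inp_def extensional_def)
qed

section \<open>Measurability in the output space and the output map\<close>

lemma component_measurable: "k \<in> idx \<Longrightarrow> (\<lambda>\<omega>. \<omega> k) \<in> borel_measurable (lebesgue_prod idx)"
  using measurable_component_singleton[of k idx "\<lambda>_. lborel :: real measure"] by simp

text \<open>The code is only assumed measurable as a function of the noise. Subtracting the uplink
  signal of message 0, which exists since \<open>M2\<close> is positive, gives a noise vector for
  which the BS receives exactly the prescribed sequence.\<close>

lemma measurable_f1_rx:
  assumes "s1 < M1" "i < n"
  shows "(\<lambda>y. f1 i s1 (rx 1 n y)) \<in> borel_measurable (lebesgue_prod idx)"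
proof -
  let ?t = "\<lambda>y. \<lambda>k\<in>idx. y k - (if fst k = 1 then g2 * f2 0 (snd k) else 0)"
  have t: "?t \<in> lebesgue_prod idx \<rightarrow>\<^sub>M lebesgue_prod idx"
    by (rule measurable_restrict) (use component_measurable in simp)
  have "(\<lambda>y. sigX1 f1 g2 f2 n s1 0 (?t y) i) \<in> borel_measurable (lebesgue_prod idx)"
    using measurable_comp[OF t measurable_X1[OF assms(1) M2 assms(2), unfolded measurable_N_iff]]
    by (simp add: comp_def)
  moreover have "sigY2 g2 f2 n 0 (?t y) = rx 1 n y" for y
    by (auto simp: sigY2_def rx_def idx_iff)
  ultimately show ?thesis by (simp add: sigX1_def)
qed

lemma out_measurable:
  assumes "s1 < M1" "s2 < M2"
  shows "out s1 s2 \<in> lebesgue_prod idx \<rightarrow>\<^sub>M lebesgue_prod idx"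
  unfolding out_def
proof (rule measurable_restrict)
  fix k assume k: "k \<in> idx"
  have "(\<lambda>\<omega>. mean s1 s2 (sigY2 g2 f2 n s2 \<omega>) k) \<in> borel_measurable (lebesgue_prod idx)"
  proof (cases "fst k = 0")
    case True
    with k have "snd k < n" by (cases k) (auto simp: idx_iff)
    from measurable_X1[OF assms this, unfolded measurable_N_iff sigX1_def] True show ?thesis
      by (simp add: mean_def)
  qed (simp add: mean_def)
  with component_measurable[OF k] show "(\<lambda>\<omega>. \<omega> k + mean s1 s2 (sigY2 g2 f2 n s2 \<omega>) k) \<in> lebesgue_prod idx \<rightarrow>\<^sub>M lborel"
    by simp
qed

lemma inp_measurable:
  assumes "s1 < M1" "s2 < M2"
  shows "inp s1 s2 \<in> lebesgue_prod idx \<rightarrow>\<^sub>M lebesgue_prod idx"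
  unfolding inp_def
proof (rule measurable_restrict)
  fix k assume k: "k \<in> idx"
  have "(\<lambda>y. mean s1 s2 (rx 1 n y) k) \<in> borel_measurable (lebesgue_prod idx)"
  proof (cases "fst k = 0")
    case True
    with k have "snd k < n" by (cases k) (auto simp: idx_iff)
    from measurable_f1_rx[OF assms(1) this] True show ?thesis
      by (simp add: mean_def)
  qed (simp add: mean_def)
  with component_measurable[OF k] show "(\<lambda>y. y k - mean s1 s2 (rx 1 n y) k) \<in> lebesgue_prod idx \<rightarrow>\<^sub>M lborel"
    by simp
qed

lemma out_correct_iff:
  assumes "\<omega> \<in> space N"
  shows "out s1 s2 \<omega> \<in> correct s1 s2 \<longleftrightarrow> \<omega> \<notin> err_event g1 g2 gm gs sg W n f1 f2 f3 dec1 dec2 s1 s2"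
proof -
  have "out s1 s2 \<omega> \<in> extensional idx" by (simp add: out_def)
  with assms show ?thesis
    by (auto simp: correct_def err_event_def rx_out space_lebesgue_prod simp del: One_nat_def)
qed

text \<open>Measurability is assumed for the error event in the noise space; the region is the
  preimage of its complement under \<open>inp\<close>, because \<open>out\<close> undoes
  \<open>inp\<close>.\<close>

lemma sets_correct:
  assumes "s1 < M1" "s2 < M2"
  shows "correct s1 s2 \<in> sets (lebesgue_prod idx)"
proof -
  let ?C = "space N - err_event g1 g2 gm gs sg W n f1 f2 f3 dec1 dec2 s1 s2"
  have "?C \<in> sets (lebesgue_prod idx)"
    using sets.compl_sets[OF sets_err[OF assms]] sets_N by simp
  from measurable_sets[OF inp_measurable[OF assms] this]
  have "inp s1 s2 -` ?C \<inter> space (lebesgue_prod idx) \<in> sets (lebesgue_prod idx)" .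
  also have "inp s1 s2 -` ?C \<inter> space (lebesgue_prod idx) = correct s1 s2"
  proof (intro set_eqI iffI)
    fix y assume y: "y \<in> inp s1 s2 -` ?C \<inter> space (lebesgue_prod idx)"
    then show "y \<in> correct s1 s2"
      using out_correct_iff[of "inp s1 s2 y" s1 s2] out_inp[of y s1 s2] by (simp add: space_lebesgue_prod)
  next
    fix y assume y: "y \<in> correct s1 s2"
    then have e: "y \<in> extensional idx" by (simp add: correct_def space_lebesgue_prod)
    have "inp s1 s2 y \<in> space N" by (simp add: space_N inp_def)
    with y e show "y \<in> inp s1 s2 -` ?C \<inter> space (lebesgue_prod idx)"
      using out_correct_iff[of "inp s1 s2 y" s1 s2] out_inp[of y s1 s2] by (simp add: space_lebesgue_prod)
  qed
  finally show ?thesis .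
qed

text \<open>A triangular shift: blocks 1 and 2 move by constants, and the displacement of block 0
  depends on the noise only through block 1.\<close>

lemma nn_integral_out:
  assumes "s1 < M1" "s2 < M2" and h: "h \<in> borel_measurable (lebesgue_prod idx)"
  shows "(\<integral>\<^sup>+ \<omega>. h (out s1 s2 \<omega>) \<partial>lebesgue_prod idx) = (\<integral>\<^sup>+ y. h y \<partial>lebesgue_prod idx)"
proof -
  let ?I = "block 1 n \<union> block 2 m" and ?J = "block 0 n"
  have U: "idx = ?I \<union> ?J" unfolding idx_split by blast
  have hc: "(\<lambda>\<omega>. h (out s1 s2 \<omega>)) \<in> borel_measurable (lebesgue_prod idx)"
    using measurable_comp[OF out_measurable[OF assms(1,2)] h] by (simp add: comp_def)
  show ?thesis
    unfolding out_def U
  proof (rule nn_integral_triangular_shift[where d="\<lambda>k. if fst k = 1 then g2 * f2 s2 (snd k) else gs * f3 s2 (snd k)"])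
    show "(\<lambda>\<omega>. h (\<lambda>k\<in>?I \<union> ?J. \<omega> k + mean s1 s2 (sigY2 g2 f2 n s2 \<omega>) k)) \<in> borel_measurable (lebesgue_prod (?I \<union> ?J))"
      using hc by (simp only: out_def U)
    show "h \<in> borel_measurable (lebesgue_prod (?I \<union> ?J))"
      using h by (simp only: U)
    show "mean s1 s2 (sigY2 g2 f2 n s2 \<omega>) k = (if fst k = 1 then g2 * f2 s2 (snd k) else gs * f3 s2 (snd k))" if "k \<in> ?I" for \<omega> k
      using that by (auto simp: mean_def)
    show "mean s1 s2 (sigY2 g2 f2 n s2 \<omega>) k = mean s1 s2 (sigY2 g2 f2 n s2 \<omega>') k"
      if "\<And>i. i \<in> ?I \<Longrightarrow> \<omega> i = \<omega>' i" for \<omega> \<omega>' k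
      using sigY2_cong[of \<omega> \<omega>' s2] that by simp
  qed auto
qed

subsection \<open>Second moments\<close>

lemma noise_component:
  assumes "k \<in> idx"
  shows "integrable N (\<lambda>\<omega>. (\<omega> k)\<^sup>2)" "(\<integral>\<omega>. (\<omega> k)\<^sup>2 \<partial>N) = sg\<^sup>2"
proof -
  let ?D = "density lborel (normal_density 0 sg)"
  have d: "distr N ?D (\<lambda>\<omega>. \<omega> k) = ?D"
    unfolding noise_def by (rule distr_PiM_component) (auto intro: prob_space_normal_density sg assms)
  have mk: "(\<lambda>\<omega>. \<omega> k) \<in> N \<rightarrow>\<^sub>M ?D"
    using component_measurable[OF assms] by (simp add: measurable_N_iff cong: measurable_cong_sets)
  have b: "has_bochner_integral lborel (\<lambda>x. normal_density 0 sg x * x\<^sup>2) (sg\<^sup>2)"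
    using normal_moment_even[OF sg, of 0 1] sg by (simp add: power2_eq_square field_simps)
  have i: "integrable ?D (\<lambda>x. x\<^sup>2)"
    using b by (subst integrable_density) (auto simp: has_bochner_integral_iff)
  have e: "(\<integral>x. x\<^sup>2 \<partial>?D) = sg\<^sup>2"
    using b by (subst integral_density) (auto simp: has_bochner_integral_iff)
  show "integrable N (\<lambda>\<omega>. (\<omega> k)\<^sup>2)"
    using i by (subst (asm) d[symmetric]) (rule integrable_distr[OF mk])
  show "(\<integral>\<omega>. (\<omega> k)\<^sup>2 \<partial>N) = sg\<^sup>2"
    using e by (subst (asm) d[symmetric], subst (asm) integral_distr[OF mk]) auto
qed

text \<open>The cross term vanishes: integrating coordinate \<open>k\<close> innermost leaves
  \<open>X\<close> constant and meets a centred Gaussian. The condition \<open>dep\<close> states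
  the independence as invariance under changing that coordinate.\<close>

lemma second_moment_add_noise:
  assumes k: "k \<in> idx" and X: "X \<in> borel_measurable N" "integrable N (\<lambda>\<omega>. (X \<omega>)\<^sup>2)"
    and dep: "\<And>x t. X (x(k := t)) = X x"
  shows "integrable N (\<lambda>\<omega>. (X \<omega> + b * \<omega> k)\<^sup>2)"
    and "(\<integral>\<omega>. (X \<omega> + b * \<omega> k)\<^sup>2 \<partial>N) = (\<integral>\<omega>. (X \<omega>)\<^sup>2 \<partial>N) + b\<^sup>2 * sg\<^sup>2"
proof -
  let ?D = "density lborel (normal_density 0 sg)"
  interpret D: prob_space ?D by (rule prob_space_normal_density[OF sg])
  interpret PD: product_sigma_finite "\<lambda>_. ?D" by unfold_locales
  note nk = noise_component[OF k]
  have [measurable]: "(\<lambda>\<omega>. \<omega> k) \<in> borel_measurable N" "X \<in> borel_measurable N"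
    using component_measurable[OF k] X by (auto simp: measurable_N_iff)
  have ix: "integrable N (\<lambda>\<omega>. X \<omega> * \<omega> k)"
  proof (rule Bochner_Integration.integrable_bound[OF Bochner_Integration.integrable_add[OF X(2) nk(1)]])
    have "\<bar>x * y\<bar> \<le> x\<^sup>2 + y\<^sup>2" for x y :: real
    proof -
      have "2 * (\<bar>x\<bar> * \<bar>y\<bar>) \<le> x\<^sup>2 + y\<^sup>2" using sum_squares_bound[of "\<bar>x\<bar>" "\<bar>y\<bar>"] by simp
      then show ?thesis unfolding abs_mult using mult_nonneg_nonneg[OF abs_ge_zero[of x] abs_ge_zero[of y]] by linarith
    qed
    then show "AE \<omega> in N. norm (X \<omega> * \<omega> k) \<le> norm ((X \<omega>)\<^sup>2 + (\<omega> k)\<^sup>2)" by simp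
  qed simp
  have "(\<integral>\<omega>. X \<omega> * \<omega> k \<partial>N) = 0"
  proof -
    let ?I = "idx - {k}"
    have U: "idx = insert k ?I" using k by auto
    have "(\<integral>\<omega>. X \<omega> * \<omega> k \<partial>PiM (insert k ?I) (\<lambda>_. ?D))
       = (\<integral>x. \<integral>z. X (x(k := z)) * (x(k := z)) k \<partial>?D \<partial>PiM ?I (\<lambda>_. ?D))"
    proof (rule PD.product_integral_insert)
      show "integrable (PiM (insert k ?I) (\<lambda>_. ?D)) (\<lambda>\<omega>. X \<omega> * \<omega> k)"
        using ix unfolding noise_def U[symmetric] .
    qed auto
    also have "(\<lambda>x. \<integral>z. X (x(k := z)) * (x(k := z)) k \<partial>?D) = (\<lambda>x. X x * (\<integral>z. z \<partial>?D))"
      by (simp add: dep)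
    also have "(\<integral>z. z \<partial>?D) = 0"
      using normal_moment_odd[OF sg, of 0 0] by (subst integral_density) (auto simp: has_bochner_integral_iff)
    finally show ?thesis unfolding noise_def U[symmetric] by simp
  qed
  moreover have eq: "(X \<omega> + b * \<omega> k)\<^sup>2 = (X \<omega>)\<^sup>2 + (2 * b) * (X \<omega> * \<omega> k) + b\<^sup>2 * (\<omega> k)\<^sup>2" for \<omega>
    by (simp add: power2_eq_square algebra_simps)
  ultimately show "(\<integral>\<omega>. (X \<omega> + b * \<omega> k)\<^sup>2 \<partial>N) = (\<integral>\<omega>. (X \<omega>)\<^sup>2 \<partial>N) + b\<^sup>2 * sg\<^sup>2"
    unfolding eq
    by (subst Bochner_Integration.integral_add
          Bochner_Integration.integral_add[OF X(2) integrable_mult_right[OF ix]],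
        intro Bochner_Integration.integrable_add X(2) integrable_mult_right ix nk,
        intro integrable_mult_right nk)
       (simp add: nk Bochner_Integration.integral_add[OF X(2) integrable_mult_right[OF ix]])
  show "integrable N (\<lambda>\<omega>. (X \<omega> + b * \<omega> k)\<^sup>2)"
    unfolding eq by (intro Bochner_Integration.integrable_add X(2) integrable_mult_right ix nk)
qed


subsection \<open>Comparison with Gaussian references\<close>

text \<open>A density against Lebesgue measure, \<open>v\<close> being standard deviations. Since
  the means may depend on the very vector \<open>y\<close> at which the density is evaluated, its
  mass is not automatically 1 and has to be computed for each choice of \<open>mu\<close>.\<close>

definition ref :: "(nat \<Rightarrow> nat \<Rightarrow> (nat \<times> nat \<Rightarrow> real) \<Rightarrow> nat \<times> nat \<Rightarrow> real) \<Rightarrow> (nat \<Rightarrow> real)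
    \<Rightarrow> nat \<Rightarrow> nat \<Rightarrow> (nat \<times> nat \<Rightarrow> real) \<Rightarrow> ennreal" where
  "ref mu v s1 s2 y = (\<Prod>k\<in>idx. ennreal (normal_density (mu s1 s2 y k) (v (fst k)) (y k)))"

text \<open>The quantity whose second moment decides how well a reference law fits the
  channel.\<close>

definition res :: "(nat \<Rightarrow> nat \<Rightarrow> (nat \<times> nat \<Rightarrow> real) \<Rightarrow> nat \<times> nat \<Rightarrow> real)
    \<Rightarrow> nat \<Rightarrow> nat \<Rightarrow> nat \<times> nat \<Rightarrow> (nat \<times> nat \<Rightarrow> real) \<Rightarrow> real" where
  "res mu s1 s2 k \<omega> = out s1 s2 \<omega> k - mu s1 s2 (out s1 s2 \<omega>) k"

lemma ref_measurable:
  assumes mu: "\<And>k. k \<in> idx \<Longrightarrow> (\<lambda>y. mu s1 s2 y k) \<in> borel_measurable (lebesgue_prod idx)"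
  shows "ref mu v s1 s2 \<in> borel_measurable (lebesgue_prod idx)"
  unfolding ref_def
proof (rule borel_measurable_prod_ennreal)
  fix k assume k: "k \<in> idx"
  note [measurable] = mu[OF k] component_measurable[OF k]
  show "(\<lambda>y. ennreal (normal_density (mu s1 s2 y k) (v (fst k)) (y k))) \<in> borel_measurable (lebesgue_prod idx)"
    unfolding normal_density_def by measurable
qed

text \<open>The log-likelihood ratio is a sum of quadratic terms, so its mean needs nothing but
  second moments; the noise energy of each coordinate yields the \<open>- 1 / 2\<close>.
  \<open>K\<close> is the number of messages being counted, either \<open>M1\<close>,
  \<open>M2\<close> or their product, and everything is summed over the uniform message
  pairs.\<close>

lemma gaussian_converse:
  assumes v: "\<And>c. 0 < v c" and K: "1 \<le> K"
    and mu: "\<And>s1 s2 k. s1 < M1 \<Longrightarrow> s2 < M2 \<Longrightarrow> k \<in> idx \<Longrightarrow> (\<lambda>y. mu s1 s2 y k) \<in> borel_measurable (lebesgue_prod idx)"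
    and sq: "\<And>s1 s2 k. s1 < M1 \<Longrightarrow> s2 < M2 \<Longrightarrow> k \<in> idx \<Longrightarrow> integrable N (\<lambda>\<omega>. (res mu s1 s2 k \<omega>)\<^sup>2)"
    and mass: "\<And>s1 s2. s1 < M1 \<Longrightarrow> s2 < M2 \<Longrightarrow> (\<integral>\<^sup>+ y. ref mu v s1 s2 y \<partial>lebesgue_prod idx) \<le> 1"
    and dec: "(\<Sum>s1<M1. \<Sum>s2<M2. \<integral>\<^sup>+ y. ref mu v s1 s2 y * indicator (correct s1 s2) y \<partial>lebesgue_prod idx)
        \<le> ennreal (real M1 * real M2 / K)"
    and err: "(\<Sum>s1<M1. \<Sum>s2<M2. measure N (err_event g1 g2 gm gs sg W n f1 f2 f3 dec1 dec2 s1 s2)) \<le> eps * real M1 * real M2"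
  shows "(1 - eps) * real M1 * real M2 * ln K \<le>
     (\<Sum>s1<M1. \<Sum>s2<M2. \<Sum>k\<in>idx. ln (v (fst k) / sg) + (\<integral>\<omega>. (res mu s1 s2 k \<omega>)\<^sup>2 \<partial>N) / (2 * (v (fst k))\<^sup>2) - 1 / 2)
     + real M1 * real M2 * ln 2"
proof -
  interpret N: prob_space N by (rule prob_space_N)
  define S where "S = {..<M1} \<times> {..<M2}"
  define A where "A p = space N - err_event g1 g2 gm gs sg W n f1 f2 f3 dec1 dec2 (fst p) (snd p)" for p
  define l where "l p \<omega> = (\<Sum>k\<in>idx. ln (v (fst k) / sg) + (res mu (fst p) (snd p) k \<omega>)\<^sup>2 / (2 * (v (fst k))\<^sup>2) - (\<omega> k)\<^sup>2 / (2 * sg\<^sup>2))" for p \<omega>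
  have S: "fst p < M1" "snd p < M2" if "p \<in> S" for p using that by (auto simp: S_def)
  have sumS: "(\<Sum>p\<in>S. F (fst p) (snd p)) = (\<Sum>s1<M1. \<Sum>s2<M2. F s1 s2)" for F :: "nat \<Rightarrow> nat \<Rightarrow> 'z::comm_monoid_add"
    unfolding S_def by (simp add: sum.cartesian_product case_prod_unfold)
  have card_S: "real (card S) = real M1 * real M2" by (simp add: S_def)
  have A: "A p \<in> sets N" if "p \<in> S" for p
    unfolding A_def using sets_err[OF S[OF that]] by (rule sets.compl_sets)
  have mres: "(\<lambda>\<omega>. res mu s1 s2 k \<omega>) \<in> borel_measurable N" if "s1 < M1" "s2 < M2" "k \<in> idx" for s1 s2 k
  proof -
    have "(\<lambda>y. y k - mu s1 s2 y k) \<in> borel_measurable (lebesgue_prod idx)"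
      using mu[OF that] component_measurable[OF that(3)] by simp
    from measurable_comp[OF out_measurable[OF that(1,2)] this] show ?thesis
      by (simp add: comp_def res_def measurable_N_iff)
  qed
  have il: "integrable N (l p)" and el: "(\<integral>\<omega>. l p \<omega> \<partial>N) = (\<Sum>k\<in>idx. ln (v (fst k) / sg)
        + (\<integral>\<omega>. (res mu (fst p) (snd p) k \<omega>)\<^sup>2 \<partial>N) / (2 * (v (fst k))\<^sup>2) - 1 / 2)" if "p \<in> S" for p
  proof -
    have i1: "integrable N (\<lambda>\<omega>. ln (v (fst k) / sg) + (res mu (fst p) (snd p) k \<omega>)\<^sup>2 / (2 * (v (fst k))\<^sup>2))" if "k \<in> idx" for k
      by (intro Bochner_Integration.integrable_add integrable_divide_zero sq S \<open>p \<in> S\<close> that N.integrable_const)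
    have i2: "integrable N (\<lambda>\<omega>. (\<omega> k)\<^sup>2 / (2 * sg\<^sup>2))" if "k \<in> idx" for k
      by (intro integrable_divide_zero noise_component that)
    show "integrable N (l p)"
      unfolding l_def by (intro Bochner_Integration.integrable_sum Bochner_Integration.integrable_diff i1 i2)
    have "(\<integral>\<omega>. l p \<omega> \<partial>N) = (\<Sum>k\<in>idx. \<integral>\<omega>. ln (v (fst k) / sg) + (res mu (fst p) (snd p) k \<omega>)\<^sup>2 / (2 * (v (fst k))\<^sup>2) - (\<omega> k)\<^sup>2 / (2 * sg\<^sup>2) \<partial>N)"
      unfolding l_def by (intro Bochner_Integration.integral_sum Bochner_Integration.integrable_diff i1 i2)
    also have "\<dots> = (\<Sum>k\<in>idx. ln (v (fst k) / sg) + (\<integral>\<omega>. (res mu (fst p) (snd p) k \<omega>)\<^sup>2 \<partial>N) / (2 * (v (fst k))\<^sup>2) - 1 / 2)"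
    proof (rule sum.cong[OF refl])
      fix k assume k: "k \<in> idx"
      have i0: "integrable N (\<lambda>\<omega>. (res mu (fst p) (snd p) k \<omega>)\<^sup>2 / (2 * (v (fst k))\<^sup>2))"
        by (intro integrable_divide_zero sq S that k)
      have "(\<integral>\<omega>. ln (v (fst k) / sg) + (res mu (fst p) (snd p) k \<omega>)\<^sup>2 / (2 * (v (fst k))\<^sup>2) - (\<omega> k)\<^sup>2 / (2 * sg\<^sup>2) \<partial>N)
          = (\<integral>\<omega>. ln (v (fst k) / sg) + (res mu (fst p) (snd p) k \<omega>)\<^sup>2 / (2 * (v (fst k))\<^sup>2) \<partial>N) - (\<integral>\<omega>. (\<omega> k)\<^sup>2 / (2 * sg\<^sup>2) \<partial>N)"
        by (rule Bochner_Integration.integral_diff[OF i1[OF k] i2[OF k]])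
      also have "(\<integral>\<omega>. (\<omega> k)\<^sup>2 / (2 * sg\<^sup>2) \<partial>N) = 1 / 2"
        using sg noise_component(2)[OF k] by simp
      also have "(\<integral>\<omega>. ln (v (fst k) / sg) + (res mu (fst p) (snd p) k \<omega>)\<^sup>2 / (2 * (v (fst k))\<^sup>2) \<partial>N)
          = ln (v (fst k) / sg) + (\<integral>\<omega>. (res mu (fst p) (snd p) k \<omega>)\<^sup>2 \<partial>N) / (2 * (v (fst k))\<^sup>2)"
        by (subst Bochner_Integration.integral_add[OF N.integrable_const i0]) (simp add: N.prob_space)
      finally show "(\<integral>\<omega>. ln (v (fst k) / sg) + (res mu (fst p) (snd p) k \<omega>)\<^sup>2 / (2 * (v (fst k))\<^sup>2) - (\<omega> k)\<^sup>2 / (2 * sg\<^sup>2) \<partial>N)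
          = ln (v (fst k) / sg) + (\<integral>\<omega>. (res mu (fst p) (snd p) k \<omega>)\<^sup>2 \<partial>N) / (2 * (v (fst k))\<^sup>2) - 1 / 2" .
    qed
    finally show "(\<integral>\<omega>. l p \<omega> \<partial>N) = (\<Sum>k\<in>idx. ln (v (fst k) / sg)
        + (\<integral>\<omega>. (res mu (fst p) (snd p) k \<omega>)\<^sup>2 \<partial>N) / (2 * (v (fst k))\<^sup>2) - 1 / 2)" .
  qed
  have mref: "ref mu v s1 s2 \<in> borel_measurable (lebesgue_prod idx)" if "s1 < M1" "s2 < M2" for s1 s2
    by (rule ref_measurable[of mu s1 s2 v, OF mu[OF that]])
  \<comment> \<open>Coordinate by coordinate, the tilting factor replaces the noise density by the
    reference density at the corresponding output.\<close>
  have tilt: "(\<Prod>k\<in>idx. ennreal (normal_density 0 sg (\<omega> k))) * ennreal (exp (- l p \<omega>)) = ref mu v (fst p) (snd p) (out (fst p) (snd p) \<omega>)" for p \<omega>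
  proof -
    have "exp (- l p \<omega>) = (\<Prod>k\<in>idx. exp (- (ln (v (fst k) / sg) + (res mu (fst p) (snd p) k \<omega>)\<^sup>2 / (2 * (v (fst k))\<^sup>2) - (\<omega> k)\<^sup>2 / (2 * sg\<^sup>2))))"
      unfolding l_def sum_negf[symmetric] by (rule exp_sum) simp
    then have "(\<Prod>k\<in>idx. normal_density 0 sg (\<omega> k)) * exp (- l p \<omega>)
       = (\<Prod>k\<in>idx. normal_density (mu (fst p) (snd p) (out (fst p) (snd p) \<omega>) k) (v (fst k)) (out (fst p) (snd p) \<omega> k))"
      by (simp only: prod.distrib[symmetric] res_def normal_density_ratio[OF v sg])
    then show ?thesis
      by (simp add: ref_def prod_ennreal prod_nonneg ennreal_mult[symmetric])
  qed
  \<comment> \<open>Tilted expectations over the noise become reference integrals over outputs: the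
    tilt supplies the density and measure preservation of \<open>out\<close> changes the
    variable.\<close>
  have change: "(\<integral>\<^sup>+ \<omega>. ennreal (exp (- l p \<omega>)) * h (out (fst p) (snd p) \<omega>) \<partial>N)
       = (\<integral>\<^sup>+ y. ref mu v (fst p) (snd p) y * h y \<partial>lebesgue_prod idx)"
    if p: "p \<in> S" and h: "h \<in> borel_measurable (lebesgue_prod idx)" for p h
  proof -
    note pS = S[OF p]
    have ml: "l p \<in> borel_measurable (lebesgue_prod idx)"
      using il[OF p] by (simp add: measurable_N_iff[symmetric])
    have mo: "(\<lambda>\<omega>. h (out (fst p) (snd p) \<omega>)) \<in> borel_measurable (lebesgue_prod idx)"
      using measurable_comp[OF out_measurable[OF pS] h] by (simp add: comp_def)
    have mn: "(\<lambda>\<omega>. \<Prod>k\<in>idx. ennreal (normal_density 0 sg (\<omega> k))) \<in> borel_measurable (lebesgue_prod idx)"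
      by (rule borel_measurable_prod_ennreal) (use component_measurable in simp)
    have "(\<integral>\<^sup>+ \<omega>. ennreal (exp (- l p \<omega>)) * h (out (fst p) (snd p) \<omega>) \<partial>N)
       = (\<integral>\<^sup>+ \<omega>. (\<Prod>k\<in>idx. ennreal (normal_density 0 sg (\<omega> k))) * (ennreal (exp (- l p \<omega>)) * h (out (fst p) (snd p) \<omega>)) \<partial>lebesgue_prod idx)"
      by (subst N_density, rule nn_integral_density[OF mn]) (use ml mo in measurable)
    also have "\<dots> = (\<integral>\<^sup>+ \<omega>. (ref mu v (fst p) (snd p) (out (fst p) (snd p) \<omega>)) * h (out (fst p) (snd p) \<omega>) \<partial>lebesgue_prod idx)"
      by (simp only: mult.assoc[symmetric] tilt)
    also have "\<dots> = (\<integral>\<^sup>+ y. ref mu v (fst p) (snd p) y * h y \<partial>lebesgue_prod idx)"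
      by (rule nn_integral_out[OF pS, of "\<lambda>y. ref mu v (fst p) (snd p) y * h y"]) (use mref[OF pS] h in measurable)
    finally show ?thesis .
  qed
  have "(\<Sum>p\<in>S. N.prob (A p)) * ln K \<le> (\<Sum>p\<in>S. N.expectation (l p)) + card S * ln 2"
  proof (rule N.change_of_measure_converse[OF _ K A il])
    show "finite S" by (simp add: S_def)
    show "(\<integral>\<^sup>+ \<omega>. ennreal (exp (- l p \<omega>)) \<partial>N) \<le> 1" if "p \<in> S" for p
      using change[OF that, of "\<lambda>_. 1"] mass[OF S[OF that]] by simp
    have "(\<Sum>p\<in>S. \<integral>\<^sup>+ \<omega>. ennreal (exp (- l p \<omega>)) * indicator (A p) \<omega> \<partial>N)
        = (\<Sum>p\<in>S. \<integral>\<^sup>+ y. ref mu v (fst p) (snd p) y * indicator (correct (fst p) (snd p)) y \<partial>lebesgue_prod idx)"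
    proof (rule sum.cong[OF refl])
      fix p assume p: "p \<in> S"
      have "(\<integral>\<^sup>+ \<omega>. ennreal (exp (- l p \<omega>)) * indicator (A p) \<omega> \<partial>N)
          = (\<integral>\<^sup>+ \<omega>. ennreal (exp (- l p \<omega>)) * indicator (correct (fst p) (snd p)) (out (fst p) (snd p) \<omega>) \<partial>N)"
        by (rule nn_integral_cong) (simp add: A_def indicator_def out_correct_iff)
      also have "\<dots> = (\<integral>\<^sup>+ y. ref mu v (fst p) (snd p) y * indicator (correct (fst p) (snd p)) y \<partial>lebesgue_prod idx)"
        using sets_correct[OF S[OF p]] by (intro change[OF p] borel_measurable_indicator)
      finally show "(\<integral>\<^sup>+ \<omega>. ennreal (exp (- l p \<omega>)) * indicator (A p) \<omega> \<partial>N)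
          = (\<integral>\<^sup>+ y. ref mu v (fst p) (snd p) y * indicator (correct (fst p) (snd p)) y \<partial>lebesgue_prod idx)" .
    qed
    also have "\<dots> = (\<Sum>s1<M1. \<Sum>s2<M2. \<integral>\<^sup>+ y. ref mu v s1 s2 y * indicator (correct s1 s2) y \<partial>lebesgue_prod idx)"
      by (rule sumS)
    finally show "(\<Sum>p\<in>S. \<integral>\<^sup>+ \<omega>. ennreal (exp (- l p \<omega>)) * indicator (A p) \<omega> \<partial>N) \<le> ennreal (real (card S) / K)"
      using dec by (simp add: card_S)
  qed
  moreover have "(\<Sum>p\<in>S. N.expectation (l p)) = (\<Sum>s1<M1. \<Sum>s2<M2. \<Sum>k\<in>idx. ln (v (fst k) / sg)
      + (\<integral>\<omega>. (res mu s1 s2 k \<omega>)\<^sup>2 \<partial>N) / (2 * (v (fst k))\<^sup>2) - 1 / 2)"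
    by (subst sumS[symmetric]) (simp add: el)
  moreover have "(1 - eps) * real M1 * real M2 * ln K \<le> (\<Sum>p\<in>S. N.prob (A p)) * ln K"
  proof (rule mult_right_mono)
    have "(\<Sum>p\<in>S. N.prob (A p)) = (\<Sum>p\<in>S. 1 - N.prob (err_event g1 g2 gm gs sg W n f1 f2 f3 dec1 dec2 (fst p) (snd p)))"
      unfolding A_def by (intro sum.cong refl N.prob_compl sets_err S)
    also have "\<dots> = real (card S) - (\<Sum>s1<M1. \<Sum>s2<M2. measure N (err_event g1 g2 gm gs sg W n f1 f2 f3 dec1 dec2 s1 s2))"
      by (simp add: sum_subtractf sumS[of "\<lambda>s1 s2. measure N (err_event g1 g2 gm gs sg W n f1 f2 f3 dec1 dec2 s1 s2)"])
    finally show "(1 - eps) * real M1 * real M2 \<le> (\<Sum>p\<in>S. N.prob (A p))"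
      using err by (simp add: card_S algebra_simps)
  qed (use K in simp)
  ultimately show ?thesis by (simp add: card_S)
qed

text \<open>Conditional means of the three reference laws, for \<open>R1\<close>, \<open>R2\<close> and \<open>R1 + R2\<close>.\<close>

definition mu_X1 :: "nat \<Rightarrow> nat \<Rightarrow> (nat \<times> nat \<Rightarrow> real) \<Rightarrow> nat \<times> nat \<Rightarrow> real" where
  "mu_X1 s1 s2 y k = (if fst k = 0 then gm * f2 s2 (snd k) else mean s1 s2 (rx 1 n y) k)"

definition mu_Y2 :: "nat \<Rightarrow> nat \<Rightarrow> (nat \<times> nat \<Rightarrow> real) \<Rightarrow> nat \<times> nat \<Rightarrow> real" where
  "mu_Y2 s1 s2 y k = (if fst k = 1 then 0 else mean s1 s2 (rx 1 n y) k)"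

definition mu_sum :: "real \<Rightarrow> nat \<Rightarrow> nat \<Rightarrow> (nat \<times> nat \<Rightarrow> real) \<Rightarrow> nat \<times> nat \<Rightarrow> real" where
  "mu_sum a s1 s2 y k = (if fst k = 1 then a * (y (0, snd k) - g1 * f1 (snd k) s1 (rx 1 n y)) else 0)"

lemma mean_measurable:
  assumes "s1 < M1" "k \<in> idx"
  shows "(\<lambda>y. mean s1 s2 (rx 1 n y) k) \<in> borel_measurable (lebesgue_prod idx)"
proof (cases "fst k = 0")
  case True
  with assms have "snd k < n" by (cases k) (auto simp: idx_iff)
  from measurable_f1_rx[OF assms(1) this] True show ?thesis
    by (simp add: mean_def)
qed (simp add: mean_def)

lemma mu_measurable:
  assumes "s1 < M1" "k \<in> idx"
  shows "(\<lambda>y. mu_X1 s1 s2 y k) \<in> borel_measurable (lebesgue_prod idx)"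
    and "(\<lambda>y. mu_Y2 s1 s2 y k) \<in> borel_measurable (lebesgue_prod idx)"
    and "(\<lambda>y. mu_sum a s1 s2 y k) \<in> borel_measurable (lebesgue_prod idx)"
proof -
  show "(\<lambda>y. mu_X1 s1 s2 y k) \<in> borel_measurable (lebesgue_prod idx)"
    "(\<lambda>y. mu_Y2 s1 s2 y k) \<in> borel_measurable (lebesgue_prod idx)"
    using mean_measurable[OF assms] unfolding mu_X1_def mu_Y2_def
    by (cases "fst k = 0"; cases "fst k = 1"; simp)+
  show "(\<lambda>y. mu_sum a s1 s2 y k) \<in> borel_measurable (lebesgue_prod idx)"
  proof (cases "fst k = 1")
    case True
    with assms have k: "snd k < n" by (cases k) (auto simp: idx_iff)
    then have k0: "(0, snd k) \<in> idx" by (simp add: idx_iff)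
    note [measurable] = measurable_f1_rx[OF assms(1) k] component_measurable[OF k0]
    have "(\<lambda>y. a * (y (0, snd k) - g1 * f1 (snd k) s1 (rx 1 n y))) \<in> borel_measurable (lebesgue_prod idx)"
      by measurable
    then show ?thesis by (simp only: mu_sum_def True if_True simp_thms)
  qed (simp add: mu_sum_def)
qed

section \<open>Total mass and decoding mass of the three reference laws\<close>

lemma ref_times_measurable:
  assumes "s1 < M1" "s2 < M2"
    and "\<And>k. k \<in> idx \<Longrightarrow> (\<lambda>y. mu s1 s2 y k) \<in> borel_measurable (lebesgue_prod idx)"
  shows "(\<lambda>y. ref mu v s1 s2 y * indicator (correct s1 s2) y) \<in> borel_measurable (lebesgue_prod idx)"
proof -
  note [measurable] = ref_measurable[of mu s1 s2 v, OF assms(3)] sets_correct[OF assms(1,2)]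
  show ?thesis by measurable
qed

text \<open>Replacing the mean of Y1 by the interference alone removes the only mean that depends on
  the outputs, leaving a product of independent Gaussians.\<close>

lemma ref_X1_mass:
  assumes v: "\<And>c. 0 < v c"
  shows "(\<integral>\<^sup>+ y. ref mu_X1 v s1 s2 y \<partial>lebesgue_prod idx) = 1"
proof -
  \<comment> \<open>\<open>undefined\<close> is a placeholder for an output vector that the means do
    not read.\<close>
  have "ref mu_X1 v s1 s2 y = (\<Prod>k\<in>idx. ennreal (normal_density (mu_X1 s1 s2 undefined k) (v (fst k)) (y k)))" for y
    unfolding ref_def by (intro prod.cong refl) (simp add: mu_X1_def mean_def)
  then show ?thesis
    using nn_integral_prod_normal_density[OF finite_idx, of "\<lambda>k. v (fst k)"] v by simp
qed

text \<open>As if M2 were told S2: for each \<open>s2\<close> the reference is the same for all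
  \<open>s1\<close>, and the decisions of M2 are disjoint, so the sum over \<open>s1\<close> is at
  most 1. Adding up over \<open>s2\<close> gives \<open>M2\<close>, written as needed for
  \<open>K\<close> equal to \<open>M1\<close>.\<close>

lemma ref_X1_decode:
  assumes v: "\<And>c. 0 < v c"
  shows "(\<Sum>s1<M1. \<Sum>s2<M2. \<integral>\<^sup>+ y. ref mu_X1 v s1 s2 y * indicator (correct s1 s2) y \<partial>lebesgue_prod idx)
    \<le> ennreal (real M1 * real M2 / real M1)"
proof -
  have eq: "ref mu_X1 v s1 s2 = ref mu_X1 v 0 s2" for s1 s2
    unfolding ref_def by (intro ext prod.cong refl) (simp add: mu_X1_def mean_def)
  have "(\<Sum>s1<M1. \<integral>\<^sup>+ y. ref mu_X1 v s1 s2 y * indicator (correct s1 s2) y \<partial>lebesgue_prod idx) \<le> 1" if "s2 < M2" for s2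
  proof -
    have "(\<Sum>s1<M1. \<integral>\<^sup>+ y. ref mu_X1 v s1 s2 y * indicator (correct s1 s2) y \<partial>lebesgue_prod idx)
       = (\<integral>\<^sup>+ y. (\<Sum>s1<M1. ref mu_X1 v s1 s2 y * indicator (correct s1 s2) y) \<partial>lebesgue_prod idx)"
      using that by (intro nn_integral_sum[symmetric] ref_times_measurable mu_measurable) auto
    also have "\<dots> = (\<integral>\<^sup>+ y. ref mu_X1 v 0 s2 y * (\<Sum>s1<M1. indicator (correct s1 s2) y) \<partial>lebesgue_prod idx)"
    proof (rule nn_integral_cong)
      fix y
      have "(\<Sum>s1<M1. ref mu_X1 v s1 s2 y * indicator (correct s1 s2) y) = (\<Sum>s1<M1. ref mu_X1 v 0 s2 y * indicator (correct s1 s2) y)"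
        by (rule sum.cong[OF refl]) (rule arg_cong2[where f="(*)", OF fun_cong[OF eq] refl])
      then show "(\<Sum>s1<M1. ref mu_X1 v s1 s2 y * indicator (correct s1 s2) y) = ref mu_X1 v 0 s2 y * (\<Sum>s1<M1. indicator (correct s1 s2) y)"
        by (simp only: sum_distrib_left)
    qed
    also have "\<dots> \<le> (\<integral>\<^sup>+ y. ref mu_X1 v 0 s2 y * 1 \<partial>lebesgue_prod idx)"
    proof (intro nn_integral_mono mult_left_mono)
      show "(\<Sum>s1<M1. indicator (correct s1 s2) y) \<le> (1 :: ennreal)" for y
        by (rule sum_indicator_le_one[where d="dec1 (rx 0 n y) (rx 2 m y)"]) (auto simp: correct_def)
    qed simp
    also have "\<dots> = 1" using ref_X1_mass[of v] v by simp
    finally show ?thesis .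
  qed
  then have "(\<Sum>s2<M2. \<Sum>s1<M1. \<integral>\<^sup>+ y. ref mu_X1 v s1 s2 y * indicator (correct s1 s2) y \<partial>lebesgue_prod idx) \<le> (\<Sum>s2<M2. 1)"
    by (intro sum_mono) simp
  also have "\<dots> = ennreal (real M1 * real M2 / real M1)" using M1 by (simp add: ennreal_of_nat_eq_real_of_nat)
  finally show ?thesis by (subst sum.swap)
qed

text \<open>Conditioning on Y2 fixes the input of the BS encoder, after which Y1 and Y3 are Gaussian
  with constant means.\<close>

lemma ref_Y2_fold:
  assumes v: "\<And>c. 0 < v c" and x: "x \<in> space (lebesgue_prod (block 1 n))"
  defines "J \<equiv> block 0 n \<union> block 2 m"
  shows "ref mu_Y2 v s1 s2 (merge (block 1 n) J (x, y)) =
      (\<Prod>k\<in>block 1 n. ennreal (normal_density 0 (v (fst k)) (x k))) *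
      (\<Prod>k\<in>J. ennreal (normal_density (mean s1 s2 (rx 1 n x) k) (v (fst k)) (y k)))"
proof -
  have U: "idx = block 1 n \<union> J" unfolding idx_split J_def by blast
  have rx: "rx 1 n (merge (block 1 n) J (x, y)) = rx 1 n x"
    by (auto simp: rx_def merge_def)
  have dj: "block 1 n \<inter> J = {}" by (auto simp: J_def)
  have "(\<Prod>k\<in>block 1 n. ennreal (normal_density (mu_Y2 s1 s2 (merge (block 1 n) J (x, y)) k) (v (fst k)) (merge (block 1 n) J (x, y) k)))
     = (\<Prod>k\<in>block 1 n. ennreal (normal_density 0 (v (fst k)) (x k)))"
    by (rule prod.cong[OF refl]) (auto simp: mu_Y2_def merge_def)
  moreover have "(\<Prod>k\<in>J. ennreal (normal_density (mu_Y2 s1 s2 (merge (block 1 n) J (x, y)) k) (v (fst k)) (merge (block 1 n) J (x, y) k)))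
     = (\<Prod>k\<in>J. ennreal (normal_density (mean s1 s2 (rx 1 n x) k) (v (fst k)) (y k)))"
  proof (rule prod.cong[OF refl])
    fix k assume k: "k \<in> J"
    then have "fst k \<noteq> 1" "merge (block 1 n) J (x, y) k = y k" by (auto simp: J_def merge_def)
    then show "ennreal (normal_density (mu_Y2 s1 s2 (merge (block 1 n) J (x, y)) k) (v (fst k)) (merge (block 1 n) J (x, y) k))
      = ennreal (normal_density (mean s1 s2 (rx 1 n x) k) (v (fst k)) (y k))"
      by (simp only: mu_Y2_def rx if_False)
  qed
  ultimately show ?thesis
    unfolding ref_def U by (subst prod.union_disjoint[OF _ _ dj]) (simp_all add: J_def)
qed

lemma nn_integral_ref_Y2_section:
  assumes v: "\<And>c. 0 < v c" and x: "x \<in> space (lebesgue_prod (block 1 n))"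
  shows "(\<integral>\<^sup>+ y. ref mu_Y2 v s1 s2 (merge (block 1 n) (block 0 n \<union> block 2 m) (x, y)) \<partial>lebesgue_prod (block 0 n \<union> block 2 m))
     = (\<Prod>k\<in>block 1 n. ennreal (normal_density 0 (v (fst k)) (x k)))"
proof -
  have [measurable]: "(\<lambda>y. \<Prod>k\<in>block 0 n \<union> block 2 m. ennreal (normal_density (mean s1 s2 (rx 1 n x) k) (v (fst k)) (y k)))
      \<in> borel_measurable (lebesgue_prod (block 0 n \<union> block 2 m))"
  proof (rule borel_measurable_prod_ennreal)
    fix k assume "k \<in> block 0 n \<union> block 2 m"
    from measurable_component_singleton[OF this, of "\<lambda>_. lborel :: real measure"]
    show "(\<lambda>y. ennreal (normal_density (mean s1 s2 (rx 1 n x) k) (v (fst k)) (y k))) \<in> borel_measurable (lebesgue_prod (block 0 n \<union> block 2 m))"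
      by simp
  qed
  show ?thesis
    using v by (simp only: ref_Y2_fold[of v, OF v x] nn_integral_cmult)
      (subst nn_integral_cmult, simp, subst nn_integral_prod_normal_density, auto)
qed

lemma ref_Y2_mass:
  assumes v: "\<And>c. 0 < v c" and s: "s1 < M1" "s2 < M2"
  shows "(\<integral>\<^sup>+ y. ref mu_Y2 v s1 s2 y \<partial>lebesgue_prod idx) \<le> 1"
proof -
  let ?I = "block 1 n" and ?J = "block 0 n \<union> block 2 m"
  have U: "idx = ?I \<union> ?J" unfolding idx_split by blast
  have m: "ref mu_Y2 v s1 s2 \<in> borel_measurable (lebesgue_prod (?I \<union> ?J))"
    using ref_measurable[of mu_Y2 s1 s2 v, OF mu_measurable(2)[OF s(1)]] by (simp only: U)
  \<comment> \<open>Summation over a single message, so that the fold inequality also yields the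
    total mass.\<close>
  have "(\<Sum>s\<in>{s2}. \<integral>\<^sup>+ y. ref mu_Y2 v s1 s y \<partial>lebesgue_prod (?I \<union> ?J))
     \<le> (\<integral>\<^sup>+ x. (\<Prod>k\<in>?I. ennreal (normal_density 0 (v (fst k)) (x k))) \<partial>lebesgue_prod ?I)"
  proof (rule sum_nn_integral_fold_le)
    fix x assume "x \<in> space (lebesgue_prod ?I)"
    from nn_integral_ref_Y2_section[of v, OF v this]
    show "(\<Sum>s\<in>{s2}. \<integral>\<^sup>+ y. ref mu_Y2 v s1 s (merge ?I ?J (x, y)) \<partial>lebesgue_prod ?J)
      \<le> (\<Prod>k\<in>?I. ennreal (normal_density 0 (v (fst k)) (x k)))"
      by simp
  next
    show "ref mu_Y2 v s1 s \<in> borel_measurable (lebesgue_prod (?I \<union> ?J))" if "s \<in> {s2}" for s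
      using m that by simp
  qed auto
  also have "\<dots> = 1" by (rule nn_integral_prod_normal_density) (auto simp: v)
  finally show ?thesis by (simp only: U) simp
qed

text \<open>For fixed \<open>s1\<close> the BS decides from Y2 alone, so given Y2 only one
  \<open>s2\<close> survives. The law of Y1 and Y3 still depends on that \<open>s2\<close>, which is
  harmless because it integrates to 1.\<close>

lemma ref_Y2_decode:
  assumes v: "\<And>c. 0 < v c"
  shows "(\<Sum>s1<M1. \<Sum>s2<M2. \<integral>\<^sup>+ y. ref mu_Y2 v s1 s2 y * indicator (correct s1 s2) y \<partial>lebesgue_prod idx)
    \<le> ennreal (real M1 * real M2 / real M2)"
proof -
  let ?I = "block 1 n" and ?J = "block 0 n \<union> block 2 m"
  have U: "idx = ?I \<union> ?J" unfolding idx_split by blast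
  have "(\<Sum>s2<M2. \<integral>\<^sup>+ y. ref mu_Y2 v s1 s2 y * indicator (correct s1 s2) y \<partial>lebesgue_prod (?I \<union> ?J)) \<le> 1" if s1: "s1 < M1" for s1
  proof -
    have "(\<Sum>s2<M2. \<integral>\<^sup>+ y. ref mu_Y2 v s1 s2 y * indicator (correct s1 s2) y \<partial>lebesgue_prod (?I \<union> ?J))
       \<le> (\<integral>\<^sup>+ x. (\<Prod>k\<in>?I. ennreal (normal_density 0 (v (fst k)) (x k))) \<partial>lebesgue_prod ?I)"
    proof (rule sum_nn_integral_fold_le)
      show "(\<lambda>y. ref mu_Y2 v s1 s2 y * indicator (correct s1 s2) y) \<in> borel_measurable (lebesgue_prod (?I \<union> ?J))" if "s2 \<in> {..<M2}" for s2
        using ref_times_measurable[of s1 s2 mu_Y2 v] mu_measurable(2) s1 that by (simp only: U) simp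
      fix x assume x: "x \<in> space (lebesgue_prod ?I)"
      let ?H = "\<Prod>k\<in>?I. ennreal (normal_density 0 (v (fst k)) (x k))"
      \<comment> \<open>Correctness of both decoders is relaxed to correctness of the BS, an event
        determined by \<open>x\<close>.\<close>
      let ?D = "\<lambda>s2. {z. dec2 s1 (rx 1 n z) = s2}"
      have rx: "rx 1 n (merge ?I ?J (x, y)) = rx 1 n x" for y
        by (auto simp: rx_def merge_def)
      have "(\<integral>\<^sup>+ y. ref mu_Y2 v s1 s2 (merge ?I ?J (x, y)) * indicator (correct s1 s2) (merge ?I ?J (x, y)) \<partial>lebesgue_prod ?J)
         \<le> ?H * indicator (?D s2) x" for s2
      proof (cases "x \<in> ?D s2")
        case True
        have "(\<integral>\<^sup>+ y. ref mu_Y2 v s1 s2 (merge ?I ?J (x, y)) * indicator (correct s1 s2) (merge ?I ?J (x, y)) \<partial>lebesgue_prod ?J)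
          \<le> (\<integral>\<^sup>+ y. ref mu_Y2 v s1 s2 (merge ?I ?J (x, y)) \<partial>lebesgue_prod ?J)"
          by (intro nn_integral_mono) (simp add: indicator_def)
        then show ?thesis using True by (simp add: nn_integral_ref_Y2_section[of v, OF v x] del: One_nat_def)
      next
        case False
        then have "indicator (correct s1 s2) (merge ?I ?J (x, y)) = (0 :: ennreal)" for y
          using rx[of y] by (simp add: correct_def indicator_def)
        then show ?thesis by simp
      qed
      then have "(\<Sum>s2<M2. \<integral>\<^sup>+ y. ref mu_Y2 v s1 s2 (merge ?I ?J (x, y)) * indicator (correct s1 s2) (merge ?I ?J (x, y)) \<partial>lebesgue_prod ?J)
         \<le> (\<Sum>s2<M2. ?H * indicator (?D s2) x)"
        by (rule sum_mono)
      also have "\<dots> = ?H * (\<Sum>s2<M2. indicator (?D s2) x)" by (simp add: sum_distrib_left)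
      also have "\<dots> \<le> ?H * 1"
        by (intro mult_left_mono sum_indicator_le_one[where d="dec2 s1 (rx 1 n x)"]) auto
      finally show "(\<Sum>s2<M2. \<integral>\<^sup>+ y. ref mu_Y2 v s1 s2 (merge ?I ?J (x, y)) * indicator (correct s1 s2) (merge ?I ?J (x, y)) \<partial>lebesgue_prod ?J)
         \<le> ?H" by simp
    qed auto
    also have "\<dots> = 1" by (rule nn_integral_prod_normal_density) (auto simp: v)
    finally show ?thesis .
  qed
  then have "(\<Sum>s1<M1. \<Sum>s2<M2. \<integral>\<^sup>+ y. ref mu_Y2 v s1 s2 y * indicator (correct s1 s2) y \<partial>lebesgue_prod (?I \<union> ?J)) \<le> (\<Sum>s1<M1. 1)"
    by (intro sum_mono) simp
  also have "\<dots> = ennreal (real M1 * real M2 / real M2)" using M2 by (simp add: ennreal_of_nat_eq_real_of_nat)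
  finally show ?thesis by (simp only: U)
qed

text \<open>The factorisation is opposite to the physical order: Y1 and Y3 come before Y2 and follow
  a law free of both messages, and Y2 is predicted from Y1 and its own past.\<close>

lemma ref_sum_fold:
  defines "I \<equiv> block 0 n \<union> block 2 m"
  shows "ref (mu_sum a) v s1 s2 (merge I (block 1 n) (x, y)) =
      (\<Prod>k\<in>I. ennreal (normal_density 0 (v (fst k)) (x k))) *
      (\<Prod>i<n. ennreal (normal_density (a * (x (0, i) - g1 * f1 i s1 (rx 1 n y))) (v 1) (y (1, i))))"
proof -
  have U: "idx = I \<union> block 1 n" unfolding idx_split I_def by blast
  have rx: "rx 1 n (merge I (block 1 n) (x, y)) = rx 1 n y"
    by (auto simp: rx_def merge_def I_def)
  have dj: "I \<inter> block 1 n = {}" by (auto simp: I_def)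
  have "(\<Prod>k\<in>block 1 n. ennreal (normal_density (mu_sum a s1 s2 (merge I (block 1 n) (x, y)) k) (v (fst k)) (merge I (block 1 n) (x, y) k)))
     = (\<Prod>i<n. ennreal (normal_density (a * (x (0, i) - g1 * f1 i s1 (rx 1 n y))) (v 1) (y (1, i))))"
  proof (rule prod.reindex_bij_witness[of _ "\<lambda>i. (1, i)" snd])
    fix k assume k: "k \<in> block 1 n"
    then have m: "fst k = 1" "merge I (block 1 n) (x, y) k = y (1, snd k)"
        "merge I (block 1 n) (x, y) (0, snd k) = x (0, snd k)"
      by (auto simp: merge_def I_def)
    show "ennreal (normal_density (a * (x (0, snd k) - g1 * f1 (snd k) s1 (rx 1 n y))) (v 1) (y (1, snd k)))
       = ennreal (normal_density (mu_sum a s1 s2 (merge I (block 1 n) (x, y)) k) (v (fst k)) (merge I (block 1 n) (x, y) k))"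
      by (simp only: mu_sum_def rx m if_True simp_thms)
  qed auto
  moreover have "(\<Prod>k\<in>I. ennreal (normal_density (mu_sum a s1 s2 (merge I (block 1 n) (x, y)) k) (v (fst k)) (merge I (block 1 n) (x, y) k)))
     = (\<Prod>k\<in>I. ennreal (normal_density 0 (v (fst k)) (x k)))"
    by (rule prod.cong[OF refl]) (auto simp: mu_sum_def I_def merge_def)
  ultimately show ?thesis
    unfolding ref_def U by (subst prod.union_disjoint[OF _ _ dj]) (simp_all add: I_def)
qed

lemma measurable_f1_block:
  assumes "s1 < M1" "i < n"
  shows "(\<lambda>y. f1 i s1 (rx 1 n y)) \<in> borel_measurable (lebesgue_prod (block 1 n))"
proof -
  let ?I = "block 0 n \<union> block 2 m" and ?J = "block 1 n"
  have U: "idx = ?I \<union> ?J" unfolding idx_split by blast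
  \<comment> \<open>Freezing the blocks 0 and 2 at any value restricts measurability to block 1, the
    only one that the encoder reads.\<close>
  define x where "x = (\<lambda>k\<in>?I. 0 :: real)"
  have "(\<lambda>y. f1 i s1 (rx 1 n (merge ?I ?J (x, y)))) \<in> borel_measurable (lebesgue_prod ?J)"
    using measurable_f1_rx[OF assms] unfolding U
    by (rule measurable_merge_section) (simp add: x_def space_lebesgue_prod)
  moreover have "rx 1 n (merge ?I ?J (x, y)) = rx 1 n y" for y
    by (auto simp: rx_def merge_def)
  ultimately show ?thesis by simp
qed

text \<open>Strict causality is used here: with Y1 given, the mean of the i-th coordinate of Y2
  depends only on earlier coordinates of Y2, so they can be integrated out from the last to the
  first.\<close>

lemma nn_integral_ref_sum_section:
  assumes v: "0 < v" and s: "s1 < M1"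
  shows "(\<integral>\<^sup>+ y. (\<Prod>i<n. ennreal (normal_density (a * (x (0, i) - g1 * f1 i s1 (rx 1 n y))) v (y (1, i)))) \<partial>lebesgue_prod (block 1 n)) = 1"
proof -
  have e: "block 1 n = Pair 1 ` {..<n}" by auto
  have "(\<integral>\<^sup>+ y. (\<Prod>i<n. ennreal (normal_density (a * (x (0, i) - g1 * f1 i s1 (rx 1 n y))) v (y (Pair 1 i)))) \<partial>lebesgue_prod (Pair 1 ` {..<n})) = 1"
  proof (rule nn_integral_causal_normal_density[OF _ v])
    show "inj (Pair (1::nat) :: nat \<Rightarrow> nat \<times> nat)" by (rule injI) simp
    show "(\<lambda>y. a * (x (0, i) - g1 * f1 i s1 (rx 1 n y))) \<in> borel_measurable (lebesgue_prod (Pair 1 ` {..<n}))" if "i < n" for i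
      using measurable_f1_block[OF s that] by (simp only: e) simp
    show "a * (x (0, i) - g1 * f1 i s1 (rx 1 n y)) = a * (x (0, i) - g1 * f1 i s1 (rx 1 n y'))"
      if "i < n" "\<And>j. j < i \<Longrightarrow> y (1, j) = y' (1, j)" for i y y'
    proof -
      have "f1 i s1 (rx 1 n y) = f1 i s1 (rx 1 n y')"
        using that by (intro causal) (simp add: rx_def)
      then show ?thesis by simp
    qed
  qed
  then show ?thesis by (simp only: e)
qed

lemma prod_normal_section_measurable:
  assumes "s1 < M1"
  shows "(\<lambda>y. \<Prod>i<n. ennreal (normal_density (a * (x (0, i) - g1 * f1 i s1 (rx 1 n y))) v (y (1, i)))) \<in> borel_measurable (lebesgue_prod (block 1 n))"
proof (rule borel_measurable_prod_ennreal)
  fix i assume i: "i \<in> {..<n}"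
  then have "(1, i) \<in> block 1 n" by simp
  from measurable_component_singleton[OF this, of "\<lambda>_. lborel :: real measure"]
  have [measurable]: "(\<lambda>y. y (1, i)) \<in> borel_measurable (lebesgue_prod (block 1 n))" by simp
  have [measurable]: "(\<lambda>y. f1 i s1 (rx 1 n y)) \<in> borel_measurable (lebesgue_prod (block 1 n))"
    using measurable_f1_block[OF assms] i by simp
  show "(\<lambda>y. ennreal (normal_density (a * (x (0, i) - g1 * f1 i s1 (rx 1 n y))) v (y (1, i)))) \<in> borel_measurable (lebesgue_prod (block 1 n))"
    unfolding normal_density_def by measurable
qed

lemma ref_sum_mass:
  assumes v: "\<And>c. 0 < v c" and s: "s1 < M1" "s2 < M2"
  shows "(\<integral>\<^sup>+ y. ref (mu_sum a) v s1 s2 y \<partial>lebesgue_prod idx) \<le> 1"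
proof -
  let ?J = "block 1 n" and ?I = "block 0 n \<union> block 2 m"
  have U: "idx = ?I \<union> ?J" unfolding idx_split by blast
  have m: "ref (mu_sum a) v s1 s2 \<in> borel_measurable (lebesgue_prod (?I \<union> ?J))"
    using ref_measurable[of "mu_sum a" s1 s2 v, OF mu_measurable(3)[OF s(1)]] by (simp only: U)
  have "(\<Sum>s\<in>{s2}. \<integral>\<^sup>+ y. ref (mu_sum a) v s1 s y \<partial>lebesgue_prod (?I \<union> ?J))
     \<le> (\<integral>\<^sup>+ x. (\<Prod>k\<in>?I. ennreal (normal_density 0 (v (fst k)) (x k))) \<partial>lebesgue_prod ?I)"
  proof (rule sum_nn_integral_fold_le)
    fix x
    show "(\<Sum>s\<in>{s2}. \<integral>\<^sup>+ y. ref (mu_sum a) v s1 s (merge ?I ?J (x, y)) \<partial>lebesgue_prod ?J)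
      \<le> (\<Prod>k\<in>?I. ennreal (normal_density 0 (v (fst k)) (x k)))"
      by (simp only: ref_sum_fold nn_integral_cmult[OF prod_normal_section_measurable[OF s(1)]]
          nn_integral_ref_sum_section[OF v s(1)]) simp
  next
    show "ref (mu_sum a) v s1 s \<in> borel_measurable (lebesgue_prod (?I \<union> ?J))" if "s \<in> {s2}" for s
      using m that by simp
  qed auto
  also have "\<dots> = 1" by (rule nn_integral_prod_normal_density) (auto simp: v)
  finally show ?thesis by (simp only: U) simp
qed

text \<open>Successive decoding. Given Y1 and Y3, M2 singles out one \<open>s1\<close>; for that
  \<open>s1\<close> the regions of the BS partition the values of Y2 by \<open>s2\<close>, while the
  conditional density depends on \<open>s1\<close> but not on \<open>s2\<close>. Both message sums
  together thus cost only total mass 1, which allows \<open>K\<close> to be the product of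
  \<open>M1\<close> and \<open>M2\<close>.\<close>

lemma ref_sum_decode:
  assumes v: "\<And>c. 0 < v c"
  shows "(\<Sum>s1<M1. \<Sum>s2<M2. \<integral>\<^sup>+ y. ref (mu_sum a) v s1 s2 y * indicator (correct s1 s2) y \<partial>lebesgue_prod idx) \<le> 1"
proof -
  let ?J = "block 1 n" and ?I = "block 0 n \<union> block 2 m"
  have U: "idx = ?I \<union> ?J" unfolding idx_split by blast
  let ?h = "\<lambda>s1 s2 y. ref (mu_sum a) v s1 s2 y * indicator (correct s1 s2) y"
  have mh: "?h s1 s2 \<in> borel_measurable (lebesgue_prod (?I \<union> ?J))" if "s1 < M1" "s2 < M2" for s1 s2
    using ref_times_measurable[of s1 s2 "mu_sum a" v] mu_measurable(3) that by (simp only: U)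
  have "(\<Sum>p\<in>{..<M1} \<times> {..<M2}. \<integral>\<^sup>+ y. ?h (fst p) (snd p) y \<partial>lebesgue_prod (?I \<union> ?J))
     \<le> (\<integral>\<^sup>+ x. (\<Prod>k\<in>?I. ennreal (normal_density 0 (v (fst k)) (x k))) \<partial>lebesgue_prod ?I)"
  proof (rule sum_nn_integral_fold_le)
    show "?h (fst p) (snd p) \<in> borel_measurable (lebesgue_prod (?I \<union> ?J))" if "p \<in> {..<M1} \<times> {..<M2}" for p
      using mh[of "fst p" "snd p"] that by auto
    fix x assume x: "x \<in> space (lebesgue_prod ?I)"
    let ?H = "\<Prod>k\<in>?I. ennreal (normal_density 0 (v (fst k)) (x k))"
    let ?D = "\<lambda>s1. {z. dec1 (rx 0 n z) (rx 2 m z) = s1}"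
    let ?G = "\<lambda>s1 y. \<Prod>i<n. ennreal (normal_density (a * (x (0, i) - g1 * f1 i s1 (rx 1 n y))) (v 1) (y (1, i)))"
    have rx: "rx 0 n (merge ?I ?J (x, y)) = rx 0 n x" "rx 2 m (merge ?I ?J (x, y)) = rx 2 m x" for y
      by (auto simp: rx_def merge_def)
    have "(\<Sum>s2<M2. \<integral>\<^sup>+ y. ?h s1 s2 (merge ?I ?J (x, y)) \<partial>lebesgue_prod ?J) \<le> ?H * indicator (?D s1) x" if s1: "s1 < M1" for s1
    proof -
      \<comment> \<open>The sum over \<open>s2\<close> has to be taken under the inner integral,
        where Y2 is known; the sum over \<open>s1\<close> waits until Y2 has been integrated
        out.\<close>
      have "(\<Sum>s2<M2. \<integral>\<^sup>+ y. ?h s1 s2 (merge ?I ?J (x, y)) \<partial>lebesgue_prod ?J)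
        = (\<integral>\<^sup>+ y. (\<Sum>s2<M2. ?h s1 s2 (merge ?I ?J (x, y))) \<partial>lebesgue_prod ?J)"
        using s1 by (intro nn_integral_sum[symmetric] measurable_merge_section[OF mh x]) auto
      also have "\<dots> \<le> (\<integral>\<^sup>+ y. (?H * indicator (?D s1) x) * ?G s1 y \<partial>lebesgue_prod ?J)"
      proof (rule nn_integral_mono)
        fix y
        have "(\<Sum>s2<M2. indicator (correct s1 s2) (merge ?I ?J (x, y))) \<le> (indicator (?D s1) x :: ennreal)"
        proof (cases "x \<in> ?D s1")
          case True
          have "(\<Sum>s2<M2. indicator (correct s1 s2) (merge ?I ?J (x, y))) \<le> (1 :: ennreal)"
            by (rule sum_indicator_le_one[where d="dec2 s1 (rx 1 n (merge ?I ?J (x, y)))"]) (auto simp: correct_def)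
          with True show ?thesis by simp
        next
          case False
          then have "indicator (correct s1 s2) (merge ?I ?J (x, y)) = (0 :: ennreal)" for s2
            using rx[of y] by (simp add: correct_def indicator_def)
          then show ?thesis by simp
        qed
        then have "(?H * ?G s1 y) * (\<Sum>s2<M2. indicator (correct s1 s2) (merge ?I ?J (x, y))) \<le> (?H * ?G s1 y) * indicator (?D s1) x"
          by (rule mult_left_mono) simp
        moreover have "(\<Sum>s2<M2. ?h s1 s2 (merge ?I ?J (x, y))) = (?H * ?G s1 y) * (\<Sum>s2<M2. indicator (correct s1 s2) (merge ?I ?J (x, y)))"
          by (simp only: ref_sum_fold sum_distrib_left)
        ultimately show "(\<Sum>s2<M2. ?h s1 s2 (merge ?I ?J (x, y))) \<le> (?H * indicator (?D s1) x) * ?G s1 y"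
          by (simp only: mult_ac)
      qed
      also have "\<dots> = ?H * indicator (?D s1) x"
        by (simp only: nn_integral_cmult[OF prod_normal_section_measurable[OF s1]] nn_integral_ref_sum_section[OF v s1]) simp
      finally show ?thesis .
    qed
    then have "(\<Sum>s1<M1. \<Sum>s2<M2. \<integral>\<^sup>+ y. ?h s1 s2 (merge ?I ?J (x, y)) \<partial>lebesgue_prod ?J) \<le> (\<Sum>s1<M1. ?H * indicator (?D s1) x)"
      by (intro sum_mono) simp
    also have "\<dots> = ?H * (\<Sum>s1<M1. indicator (?D s1) x)" by (simp add: sum_distrib_left)
    also have "\<dots> \<le> ?H * 1"
      by (intro mult_left_mono sum_indicator_le_one[where d="dec1 (rx 0 n x) (rx 2 m x)"]) auto
    finally show "(\<Sum>p\<in>{..<M1} \<times> {..<M2}. \<integral>\<^sup>+ y. ?h (fst p) (snd p) (merge ?I ?J (x, y)) \<partial>lebesgue_prod ?J) \<le> ?H"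
      by (simp add: sum.cartesian_product case_prod_unfold)
  qed auto
  also have "\<dots> = 1" by (rule nn_integral_prod_normal_density) (auto simp: v)
  finally show ?thesis
    by (simp only: U sum.cartesian_product case_prod_unfold)
qed

section \<open>Block energies and matched variances\<close>

lemma out_apply: "k \<in> idx \<Longrightarrow> out s1 s2 \<omega> k = \<omega> k + mean s1 s2 (sigY2 g2 f2 n s2 \<omega>) k"
  by (simp add: out_def)

lemma second_moment_const_noise:
  assumes "k \<in> idx"
  shows "integrable N (\<lambda>\<omega>. (c + b * \<omega> k)\<^sup>2)" "(\<integral>\<omega>. (c + b * \<omega> k)\<^sup>2 \<partial>N) = c\<^sup>2 + b\<^sup>2 * sg\<^sup>2"
proof -
  interpret N: prob_space N by (rule prob_space_N)
  show "integrable N (\<lambda>\<omega>. (c + b * \<omega> k)\<^sup>2)" "(\<integral>\<omega>. (c + b * \<omega> k)\<^sup>2 \<partial>N) = c\<^sup>2 + b\<^sup>2 * sg\<^sup>2"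
    using second_moment_add_noise[OF assms, of "\<lambda>_. c" b] by (auto simp: N.prob_space)
qed

lemma sum_idx: "(\<Sum>k\<in>idx. F k) = (\<Sum>i<n. F (0, i)) + (\<Sum>i<n. F (1, i)) + (\<Sum>j<m. F (2, j))"
  for F :: "nat \<times> nat \<Rightarrow> 'z::comm_monoid_add"
proof -
  have b: "(\<Sum>k\<in>block c l. F k) = (\<Sum>i<l. F (c, i))" for c l :: nat
    by (rule sum.reindex_bij_witness[of _ "Pair c" snd]) auto
  have "(\<Sum>k\<in>idx. F k) = (\<Sum>k\<in>block 0 n. F k) + (\<Sum>k\<in>block 1 n. F k) + (\<Sum>k\<in>block 2 m. F k)"
    unfolding idx_split
    by (subst sum.union_disjoint, simp, simp, force, subst sum.union_disjoint) auto
  then show ?thesis by (simp only: b)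
qed

text \<open>As the variance is constant along a block, only total energies enter, averaged over
  messages: \<open>d0\<close>, \<open>d1\<close> and \<open>d2\<close> bound them for the three
  blocks.\<close>

lemma gaussian_converse_blocks:
  assumes v: "\<And>c. 0 < v c" and K: "1 \<le> K"
    and mu: "\<And>s1 s2 k. s1 < M1 \<Longrightarrow> s2 < M2 \<Longrightarrow> k \<in> idx \<Longrightarrow> (\<lambda>y. mu s1 s2 y k) \<in> borel_measurable (lebesgue_prod idx)"
    and sq: "\<And>s1 s2 k. s1 < M1 \<Longrightarrow> s2 < M2 \<Longrightarrow> k \<in> idx \<Longrightarrow>
        integrable N (\<lambda>\<omega>. (res mu s1 s2 k \<omega>)\<^sup>2) \<and> (\<integral>\<omega>. (res mu s1 s2 k \<omega>)\<^sup>2 \<partial>N) = E s1 s2 k"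
    and mass: "\<And>s1 s2. s1 < M1 \<Longrightarrow> s2 < M2 \<Longrightarrow> (\<integral>\<^sup>+ y. ref mu v s1 s2 y \<partial>lebesgue_prod idx) \<le> 1"
    and dec: "(\<Sum>s1<M1. \<Sum>s2<M2. \<integral>\<^sup>+ y. ref mu v s1 s2 y * indicator (correct s1 s2) y \<partial>lebesgue_prod idx)
        \<le> ennreal (real M1 * real M2 / K)"
    and err: "(\<Sum>s1<M1. \<Sum>s2<M2. measure N (err_event g1 g2 gm gs sg W n f1 f2 f3 dec1 dec2 s1 s2)) \<le> eps * real M1 * real M2"
    and d0: "(\<Sum>s1<M1. \<Sum>s2<M2. \<Sum>i<n. E s1 s2 (0, i)) \<le> real M1 * real M2 * d0"
    and d1: "(\<Sum>s1<M1. \<Sum>s2<M2. \<Sum>i<n. E s1 s2 (1, i)) \<le> real M1 * real M2 * d1"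
    and d2: "(\<Sum>s1<M1. \<Sum>s2<M2. \<Sum>j<m. E s1 s2 (2, j)) \<le> real M1 * real M2 * d2"
  shows "(1 - eps) * ln K \<le> (n * (ln (v 0 / sg) - 1 / 2) + d0 / (2 * (v 0)\<^sup>2))
     + (n * (ln (v 1 / sg) - 1 / 2) + d1 / (2 * (v 1)\<^sup>2))
     + (m * (ln (v 2 / sg) - 1 / 2) + d2 / (2 * (v 2)\<^sup>2)) + ln 2"
proof -
  have blk: "(\<Sum>s1<M1. \<Sum>s2<M2. \<Sum>i<l. ln (v c / sg) + E s1 s2 (c, i) / (2 * (v c)\<^sup>2) - 1 / 2)
      \<le> real M1 * real M2 * (l * (ln (v c / sg) - 1 / 2) + d / (2 * (v c)\<^sup>2))"
    if d: "(\<Sum>s1<M1. \<Sum>s2<M2. \<Sum>i<l. E s1 s2 (c, i)) \<le> real M1 * real M2 * d" for c l :: nat and d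
  proof -
    have "(\<Sum>s1<M1. \<Sum>s2<M2. \<Sum>i<l. ln (v c / sg) + E s1 s2 (c, i) / (2 * (v c)\<^sup>2) - 1 / 2)
      = (\<Sum>s1<M1. \<Sum>s2<M2. \<Sum>i<l. (ln (v c / sg) - 1 / 2) + E s1 s2 (c, i) / (2 * (v c)\<^sup>2))"
      by (simp add: algebra_simps)
    also have "\<dots> = real M1 * real M2 * (l * (ln (v c / sg) - 1 / 2)) + (\<Sum>s1<M1. \<Sum>s2<M2. \<Sum>i<l. E s1 s2 (c, i)) / (2 * (v c)\<^sup>2)"
      by (simp only: sum.distrib sum_divide_distrib[symmetric] sum_constant card_lessThan mult.assoc)
    also have "\<dots> \<le> real M1 * real M2 * (l * (ln (v c / sg) - 1 / 2)) + (real M1 * real M2 * d) / (2 * (v c)\<^sup>2)"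
      by (intro add_left_mono divide_right_mono d) simp
    finally show ?thesis by (simp add: algebra_simps)
  qed
  have "(1 - eps) * real M1 * real M2 * ln K \<le>
     (\<Sum>s1<M1. \<Sum>s2<M2. \<Sum>k\<in>idx. ln (v (fst k) / sg) + (\<integral>\<omega>. (res mu s1 s2 k \<omega>)\<^sup>2 \<partial>N) / (2 * (v (fst k))\<^sup>2) - 1 / 2)
     + real M1 * real M2 * ln 2"
    by (rule gaussian_converse[OF v K mu _ mass dec err]) (use sq in auto)
  also have "(\<Sum>s1<M1. \<Sum>s2<M2. \<Sum>k\<in>idx. ln (v (fst k) / sg) + (\<integral>\<omega>. (res mu s1 s2 k \<omega>)\<^sup>2 \<partial>N) / (2 * (v (fst k))\<^sup>2) - 1 / 2)
     = (\<Sum>s1<M1. \<Sum>s2<M2. \<Sum>k\<in>idx. ln (v (fst k) / sg) + E s1 s2 k / (2 * (v (fst k))\<^sup>2) - 1 / 2)"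
    by (intro sum.cong refl) (use sq in auto)
  also have "\<dots> = (\<Sum>s1<M1. \<Sum>s2<M2. \<Sum>i<n. ln (v 0 / sg) + E s1 s2 (0, i) / (2 * (v 0)\<^sup>2) - 1 / 2)
     + (\<Sum>s1<M1. \<Sum>s2<M2. \<Sum>i<n. ln (v 1 / sg) + E s1 s2 (1, i) / (2 * (v 1)\<^sup>2) - 1 / 2)
     + (\<Sum>s1<M1. \<Sum>s2<M2. \<Sum>j<m. ln (v 2 / sg) + E s1 s2 (2, j) / (2 * (v 2)\<^sup>2) - 1 / 2)"
    by (simp only: sum_idx sum.distrib fst_conv)
  finally have "(1 - eps) * real M1 * real M2 * ln K \<le>
       real M1 * real M2 * (n * (ln (v 0 / sg) - 1 / 2) + d0 / (2 * (v 0)\<^sup>2))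
     + real M1 * real M2 * (n * (ln (v 1 / sg) - 1 / 2) + d1 / (2 * (v 1)\<^sup>2))
     + real M1 * real M2 * (m * (ln (v 2 / sg) - 1 / 2) + d2 / (2 * (v 2)\<^sup>2)) + real M1 * real M2 * ln 2"
    using blk[OF d0] blk[OF d1] blk[OF d2] by linarith
  then have "(real M1 * real M2) * ((1 - eps) * ln K) \<le> (real M1 * real M2) *
     ((n * (ln (v 0 / sg) - 1 / 2) + d0 / (2 * (v 0)\<^sup>2))
     + (n * (ln (v 1 / sg) - 1 / 2) + d1 / (2 * (v 1)\<^sup>2))
     + (m * (ln (v 2 / sg) - 1 / 2) + d2 / (2 * (v 2)\<^sup>2)) + ln 2)"
    by (simp only: ring_distribs mult_ac)
  moreover have "0 < real M1 * real M2" using M1 M2 by simp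
  ultimately show ?thesis by (simp only: mult_le_cancel_left_pos)
qed

text \<open>With variance equal to the energy per symbol, the quadratic term is 1/2 per symbol and
  cancels the \<open>- 1 / 2\<close> coming from the noise, so only the logarithm remains.\<close>

lemma matched_block:
  assumes "0 < w"
  shows "l * (ln (sqrt w / sg) - 1 / 2) + (l * w) / (2 * (sqrt w)\<^sup>2) = l / 2 * ln (w / sg\<^sup>2)"
proof -
  have "ln (sqrt w / sg) = ln (w / sg\<^sup>2) / 2"
    using assms sg by (simp add: ln_div ln_sqrt ln_realpow)
  then show ?thesis using assms by (simp add: field_simps)
qed

text \<open>\<open>p\<close> and \<open>r\<close> bound the power of M1 on the main channel and on
  the side-channel. Both are measured per main-channel symbol, hence the factor \<open>n\<close> and
  not \<open>m\<close> in the bound on \<open>f3\<close>.\<close>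

context
  fixes P1 p r eps :: real
  assumes P1: "0 \<le> P1" and p: "0 \<le> p" and r: "0 \<le> r" and W: "0 \<le> W"
    and power_X1: "(\<Sum>s1<M1. \<Sum>s2<M2. \<integral>\<^sup>+ \<omega>. ennreal (\<Sum>i<n. (sigX1 f1 g2 f2 n s1 s2 \<omega> i)\<^sup>2) \<partial>N)
       \<le> ennreal (real M1 * real M2 * real n * P1)"
    and power_X2: "(\<Sum>s2<M2. \<Sum>i<n. (f2 s2 i)\<^sup>2) \<le> real M2 * real n * p"
    and power_X3: "(\<Sum>s2<M2. \<Sum>j<m. (f3 s2 j)\<^sup>2) \<le> real M2 * real n * r"
    and err: "(\<Sum>s1<M1. \<Sum>s2<M2. measure N (err_event g1 g2 gm gs sg W n f1 f2 f3 dec1 dec2 s1 s2)) \<le> eps * real M1 * real M2"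
begin

abbreviation X :: "nat \<Rightarrow> nat \<Rightarrow> nat \<Rightarrow> (nat \<times> nat \<Rightarrow> real) \<Rightarrow> real" where
  "X s1 s2 i \<omega> \<equiv> sigX1 f1 g2 f2 n s1 s2 \<omega> i"

text \<open>A single summand is at most the total over messages and times, which the power
  constraint makes finite.\<close>

lemma X_square_integrable:
  assumes s: "s1 < M1" "s2 < M2" and i: "i < n"
  shows "integrable N (\<lambda>\<omega>. (X s1 s2 i \<omega>)\<^sup>2)"
proof (rule integrableI_bounded)
  show "(\<lambda>\<omega>. (X s1 s2 i \<omega>)\<^sup>2) \<in> borel_measurable N"
    using measurable_X1[OF s i] by simp
  have "(\<integral>\<^sup>+ \<omega>. ennreal (norm ((X s1 s2 i \<omega>)\<^sup>2)) \<partial>N) \<le> (\<integral>\<^sup>+ \<omega>. ennreal (\<Sum>i<n. (X s1 s2 i \<omega>)\<^sup>2) \<partial>N)"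
    using i by (intro nn_integral_mono ennreal_leI) (auto intro!: member_le_sum)
  also have "\<dots> \<le> (\<Sum>s2<M2. \<integral>\<^sup>+ \<omega>. ennreal (\<Sum>i<n. (X s1 s2 i \<omega>)\<^sup>2) \<partial>N)"
    using s by (intro member_le_sum) auto
  also have "\<dots> \<le> (\<Sum>s1<M1. \<Sum>s2<M2. \<integral>\<^sup>+ \<omega>. ennreal (\<Sum>i<n. (X s1 s2 i \<omega>)\<^sup>2) \<partial>N)"
    using s by (intro member_le_sum[of s1 _ "\<lambda>s1. \<Sum>s2<M2. \<integral>\<^sup>+ \<omega>. ennreal (\<Sum>i<n. (X s1 s2 i \<omega>)\<^sup>2) \<partial>N"]) auto
  also note power_X1
  finally show "(\<integral>\<^sup>+ \<omega>. ennreal (norm ((X s1 s2 i \<omega>)\<^sup>2)) \<partial>N) < \<infinity>"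
    by (rule le_less_trans) simp
qed

lemma X_power: "(\<Sum>s1<M1. \<Sum>s2<M2. \<Sum>i<n. \<integral>\<omega>. (X s1 s2 i \<omega>)\<^sup>2 \<partial>N) \<le> real M1 * real M2 * (n * P1)"
proof -
  have "ennreal (\<Sum>s1<M1. \<Sum>s2<M2. \<Sum>i<n. \<integral>\<omega>. (X s1 s2 i \<omega>)\<^sup>2 \<partial>N)
     = (\<Sum>s1<M1. \<Sum>s2<M2. ennreal (\<Sum>i<n. \<integral>\<omega>. (X s1 s2 i \<omega>)\<^sup>2 \<partial>N))"
    by (simp add: sum_nonneg)
  also have "\<dots> = (\<Sum>s1<M1. \<Sum>s2<M2. \<integral>\<^sup>+ \<omega>. ennreal (\<Sum>i<n. (X s1 s2 i \<omega>)\<^sup>2) \<partial>N)"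
  proof (intro sum.cong refl)
    fix s1 s2 assume "s1 \<in> {..<M1}" "s2 \<in> {..<M2}"
    then have int: "integrable N (\<lambda>\<omega>. (X s1 s2 i \<omega>)\<^sup>2)" if "i \<in> {..<n}" for i
      using X_square_integrable that by simp
    have "(\<integral>\<^sup>+ \<omega>. ennreal (\<Sum>i<n. (X s1 s2 i \<omega>)\<^sup>2) \<partial>N) = ennreal (\<integral>\<omega>. (\<Sum>i<n. (X s1 s2 i \<omega>)\<^sup>2) \<partial>N)"
      by (intro nn_integral_eq_integral Bochner_Integration.integrable_sum int) (auto intro!: AE_I2 sum_nonneg)
    also have "(\<integral>\<omega>. (\<Sum>i<n. (X s1 s2 i \<omega>)\<^sup>2) \<partial>N) = (\<Sum>i<n. \<integral>\<omega>. (X s1 s2 i \<omega>)\<^sup>2 \<partial>N)"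
      by (intro Bochner_Integration.integral_sum int)
    finally show "ennreal (\<Sum>i<n. \<integral>\<omega>. (X s1 s2 i \<omega>)\<^sup>2 \<partial>N) = (\<integral>\<^sup>+ \<omega>. ennreal (\<Sum>i<n. (X s1 s2 i \<omega>)\<^sup>2) \<partial>N)" by simp
  qed
  also have "\<dots> \<le> ennreal (real M1 * real M2 * real n * P1)" by (rule power_X1)
  finally show ?thesis
    using P1 by (subst (asm) ennreal_le_iff) (auto simp: mult_ac)
qed

text \<open>The BS hears Y2 only, so its input is insensitive to the noise of M2 in coordinate (0,
  i). The last clause is nonnegativity of the variance.\<close>

lemma second_moment_X:
  assumes s: "s1 < M1" "s2 < M2" and i: "i < n"
  shows "integrable N (\<lambda>\<omega>. (b * X s1 s2 i \<omega> + c)\<^sup>2)"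
    and "(\<integral>\<omega>. (b * X s1 s2 i \<omega> + c)\<^sup>2 \<partial>N) = b\<^sup>2 * (\<integral>\<omega>. (X s1 s2 i \<omega>)\<^sup>2 \<partial>N) + 2 * b * (c * (\<integral>\<omega>. X s1 s2 i \<omega> \<partial>N)) + c\<^sup>2"
    and "integrable N (\<lambda>\<omega>. (b * X s1 s2 i \<omega> + c + 1 * \<omega> (0, i))\<^sup>2)"
    and "(\<integral>\<omega>. (b * X s1 s2 i \<omega> + c + 1 * \<omega> (0, i))\<^sup>2 \<partial>N)
       = b\<^sup>2 * (\<integral>\<omega>. (X s1 s2 i \<omega>)\<^sup>2 \<partial>N) + 2 * b * (c * (\<integral>\<omega>. X s1 s2 i \<omega> \<partial>N)) + c\<^sup>2 + sg\<^sup>2"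
    and "(\<integral>\<omega>. X s1 s2 i \<omega> \<partial>N)\<^sup>2 \<le> (\<integral>\<omega>. (X s1 s2 i \<omega>)\<^sup>2 \<partial>N)"
proof -
  interpret N: prob_space N by (rule prob_space_N)
  note m = measurable_X1[OF s i] and sq = X_square_integrable[OF s i]
  have x: "integrable N (X s1 s2 i)"
    by (rule N.square_integrable_imp_integrable[OF m sq])
  have e: "(\<lambda>\<omega>. (b * X s1 s2 i \<omega> + c)\<^sup>2) = (\<lambda>\<omega>. b\<^sup>2 * (X s1 s2 i \<omega>)\<^sup>2 + (2 * b * c) * X s1 s2 i \<omega> + c\<^sup>2)"
    by (auto simp: power2_eq_square algebra_simps)
  have i2: "integrable N (\<lambda>\<omega>. b\<^sup>2 * (X s1 s2 i \<omega>)\<^sup>2 + (2 * b * c) * X s1 s2 i \<omega>)"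
    by (intro Bochner_Integration.integrable_add integrable_mult_right sq x)
  show 1: "integrable N (\<lambda>\<omega>. (b * X s1 s2 i \<omega> + c)\<^sup>2)"
    unfolding e by (intro Bochner_Integration.integrable_add i2 N.integrable_const)
  show 2: "(\<integral>\<omega>. (b * X s1 s2 i \<omega> + c)\<^sup>2 \<partial>N) = b\<^sup>2 * (\<integral>\<omega>. (X s1 s2 i \<omega>)\<^sup>2 \<partial>N) + 2 * b * (c * (\<integral>\<omega>. X s1 s2 i \<omega> \<partial>N)) + c\<^sup>2"
    unfolding e
    by (subst Bochner_Integration.integral_add[OF i2 N.integrable_const],
        subst Bochner_Integration.integral_add[OF integrable_mult_right[OF sq] integrable_mult_right[OF x]])
       (simp add: N.prob_space)
  have k: "(0, i) \<in> idx" using i by (simp add: idx_iff)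
  have mX: "(\<lambda>\<omega>. b * X s1 s2 i \<omega> + c) \<in> borel_measurable N" using m by simp
  have dep: "b * X s1 s2 i (x((0, i) := t)) + c = b * X s1 s2 i x + c" for x t
    using sigY2_cong[of "x((0, i) := t)" x s2] by (simp add: sigX1_def)
  show "integrable N (\<lambda>\<omega>. (b * X s1 s2 i \<omega> + c + 1 * \<omega> (0, i))\<^sup>2)"
    by (rule second_moment_add_noise(1)[OF k mX 1 dep])
  show "(\<integral>\<omega>. (b * X s1 s2 i \<omega> + c + 1 * \<omega> (0, i))\<^sup>2 \<partial>N)
       = b\<^sup>2 * (\<integral>\<omega>. (X s1 s2 i \<omega>)\<^sup>2 \<partial>N) + 2 * b * (c * (\<integral>\<omega>. X s1 s2 i \<omega> \<partial>N)) + c\<^sup>2 + sg\<^sup>2"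
    by (subst second_moment_add_noise(2)[OF k mX 1 dep]) (simp add: 2)
  show "(\<integral>\<omega>. X s1 s2 i \<omega> \<partial>N)\<^sup>2 \<le> (\<integral>\<omega>. (X s1 s2 i \<omega>)\<^sup>2 \<partial>N)"
    using N.variance_eq[OF x sq] N.variance_positive[of "X s1 s2 i"] by linarith
qed

text \<open>Here the coherent gain arises. For fixed messages X2 is a constant, so the cross term
  sees X1 only through its mean; Cauchy-Schwarz over all messages and times then bounds the total
  correlation by the geometric mean of the two powers.\<close>

lemma superposition_power:
  "(\<Sum>s1<M1. \<Sum>s2<M2. \<Sum>i<n. g1\<^sup>2 * (\<integral>\<omega>. (X s1 s2 i \<omega>)\<^sup>2 \<partial>N)
       + 2 * g1 * (gm * f2 s2 i * (\<integral>\<omega>. X s1 s2 i \<omega> \<partial>N)) + (gm * f2 s2 i)\<^sup>2 + sg\<^sup>2)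
   \<le> real M1 * real M2 * (n * (sg\<^sup>2 + g1\<^sup>2 * P1 + gm\<^sup>2 * p + 2 * \<bar>g1 * gm\<bar> * sqrt (P1 * p)))"
proof -
  define S where "S = {..<M1} \<times> {..<M2} \<times> {..<n}"
  define T where "T = real M1 * real M2 * real n"
  have sumS: "(\<Sum>s1<M1. \<Sum>s2<M2. \<Sum>i<n. F s1 s2 i) = (\<Sum>(s1, s2, i)\<in>S. F s1 s2 i)" for F :: "nat \<Rightarrow> nat \<Rightarrow> nat \<Rightarrow> real"
    by (simp add: S_def sum.cartesian_product)
  define A where "A = (\<Sum>(s1, s2, i)\<in>S. \<integral>\<omega>. (X s1 s2 i \<omega>)\<^sup>2 \<partial>N)"
  define Z where "Z = (\<Sum>(s1, s2, i)\<in>S. f2 s2 i * (\<integral>\<omega>. X s1 s2 i \<omega> \<partial>N))"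
  define B where "B = (\<Sum>(s1, s2, i)\<in>S. (f2 s2 i)\<^sup>2)"
  have T: "0 \<le> T" by (simp add: T_def)
  have A: "A \<le> T * P1" unfolding A_def sumS[symmetric] T_def using X_power by (simp only: mult.assoc)
  have B: "B \<le> T * p"
  proof -
    have "B = real M1 * (\<Sum>s2<M2. \<Sum>i<n. (f2 s2 i)\<^sup>2)" unfolding B_def sumS[symmetric] by simp
    also have "\<dots> \<le> real M1 * (real M2 * real n * p)" by (intro mult_left_mono power_X2) simp
    finally show ?thesis by (simp add: T_def mult_ac)
  qed
  have A0: "0 \<le> A" unfolding A_def by (auto intro!: sum_nonneg)
  have B0: "0 \<le> B" unfolding B_def by (auto intro!: sum_nonneg)
  have "Z\<^sup>2 \<le> (\<Sum>(s1, s2, i)\<in>S. (f2 s2 i)\<^sup>2) * (\<Sum>(s1, s2, i)\<in>S. (\<integral>\<omega>. X s1 s2 i \<omega> \<partial>N)\<^sup>2)"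
    unfolding Z_def case_prod_unfold by (rule Cauchy_Schwarz_ineq_sum)
  \<comment> \<open>Squared means are replaced by second moments, to which the power constraint
    applies.\<close>
  also have "\<dots> \<le> B * A"
    unfolding B_def[symmetric] A_def using second_moment_X(5)
    by (intro mult_left_mono sum_mono B0) (auto simp: S_def)
  also have "\<dots> \<le> (T * p) * (T * P1)"
    using A B A0 B0 T p by (intro mult_mono) auto
  also have "\<dots> = (T * sqrt (P1 * p))\<^sup>2"
    using P1 p by (simp add: power_mult_distrib power2_eq_square)
  finally have "\<bar>Z\<bar> \<le> \<bar>T * sqrt (P1 * p)\<bar>"
    by (simp only: abs_le_square_iff)
  then have Z: "\<bar>Z\<bar> \<le> T * sqrt (P1 * p)"
    using T P1 p by simp
  have expand: "g1\<^sup>2 * u + 2 * g1 * (gm * x * e) + (gm * x)\<^sup>2 + sg\<^sup>2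
      = g1\<^sup>2 * u + (2 * (g1 * gm)) * (x * e) + gm\<^sup>2 * x\<^sup>2 + sg\<^sup>2" for u x e
    by (simp add: power_mult_distrib)
  have const: "(\<Sum>q\<in>S. sg\<^sup>2) = T * sg\<^sup>2"
    by (simp add: S_def T_def)
  have "(\<Sum>s1<M1. \<Sum>s2<M2. \<Sum>i<n. g1\<^sup>2 * (\<integral>\<omega>. (X s1 s2 i \<omega>)\<^sup>2 \<partial>N)
       + 2 * g1 * (gm * f2 s2 i * (\<integral>\<omega>. X s1 s2 i \<omega> \<partial>N)) + (gm * f2 s2 i)\<^sup>2 + sg\<^sup>2)
    = (\<Sum>(s1, s2, i)\<in>S. g1\<^sup>2 * (\<integral>\<omega>. (X s1 s2 i \<omega>)\<^sup>2 \<partial>N)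
       + (2 * (g1 * gm)) * (f2 s2 i * (\<integral>\<omega>. X s1 s2 i \<omega> \<partial>N)) + gm\<^sup>2 * (f2 s2 i)\<^sup>2 + sg\<^sup>2)"
    by (simp only: expand sumS)
  also have "\<dots> = g1\<^sup>2 * A + (2 * (g1 * gm)) * Z + gm\<^sup>2 * B + T * sg\<^sup>2"
    by (simp only: A_def Z_def B_def case_prod_unfold sum.distrib sum_distrib_left[symmetric] const)
  also have "\<dots> \<le> g1\<^sup>2 * (T * P1) + (2 * \<bar>g1 * gm\<bar>) * (T * sqrt (P1 * p)) + gm\<^sup>2 * (T * p) + T * sg\<^sup>2"
  proof (intro add_mono mult_left_mono A B order_refl)
    have "(2 * (g1 * gm)) * Z \<le> \<bar>(2 * (g1 * gm)) * Z\<bar>" by (rule abs_ge_self)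
    also have "\<dots> = (2 * \<bar>g1 * gm\<bar>) * \<bar>Z\<bar>" by (simp add: abs_mult)
    also have "\<dots> \<le> (2 * \<bar>g1 * gm\<bar>) * (T * sqrt (P1 * p))" by (intro mult_left_mono Z) simp
    finally show "(2 * (g1 * gm)) * Z \<le> (2 * \<bar>g1 * gm\<bar>) * (T * sqrt (P1 * p))" .
  qed (auto simp: T)
  also have "\<dots> = real M1 * real M2 * (n * (sg\<^sup>2 + g1\<^sup>2 * P1 + gm\<^sup>2 * p + 2 * \<bar>g1 * gm\<bar> * sqrt (P1 * p)))"
    by (simp add: T_def algebra_simps)
  finally show ?thesis .
qed

section \<open>Rate bounds for a single code\<close>

lemma downlink_bound: "(1 - eps) * ln M1 \<le> n / 2 * ln (1 + g1\<^sup>2 * P1 / sg\<^sup>2) + ln 2"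
proof -
  define w where "w = sg\<^sup>2 + g1\<^sup>2 * P1"
  have w: "0 < w" using sg P1 unfolding w_def by (intro add_pos_nonneg) auto
  \<comment> \<open>Blocks 1 and 2 keep their true law, with residual energy \<open>sg\<close>
    squared per symbol, so they contribute 0 to the bound.\<close>
  define v where "v c = (if c = 0 then sqrt w else sg)" for c :: nat
  have v: "0 < v c" for c using w sg by (simp add: v_def)
  define E where "E s1 s2 k = (if fst k = 0 then g1\<^sup>2 * (\<integral>\<omega>. (X s1 s2 (snd k) \<omega>)\<^sup>2 \<partial>N) + sg\<^sup>2 else sg\<^sup>2)" for s1 s2 :: nat and k :: "nat \<times> nat"
  have "(1 - eps) * ln M1 \<le> (n * (ln (v 0 / sg) - 1 / 2) + (n * w) / (2 * (v 0)\<^sup>2))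
     + (n * (ln (v 1 / sg) - 1 / 2) + (n * sg\<^sup>2) / (2 * (v 1)\<^sup>2))
     + (m * (ln (v 2 / sg) - 1 / 2) + (m * sg\<^sup>2) / (2 * (v 2)\<^sup>2)) + ln 2"
  proof (rule gaussian_converse_blocks[where mu=mu_X1 and E=E])
    show "1 \<le> real M1" using M1 by simp
    show "(\<lambda>y. mu_X1 s1 s2 y k) \<in> borel_measurable (lebesgue_prod idx)" if "s1 < M1" "k \<in> idx" for s1 s2 k
      using that by (rule mu_measurable)
    show "integrable N (\<lambda>\<omega>. (res mu_X1 s1 s2 k \<omega>)\<^sup>2) \<and> (\<integral>\<omega>. (res mu_X1 s1 s2 k \<omega>)\<^sup>2 \<partial>N) = E s1 s2 k"
      if s: "s1 < M1" "s2 < M2" and k: "k \<in> idx" for s1 s2 k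
    proof (cases "fst k = 0")
      case True
      then obtain i where k_eq: "k = (0, i)" and i: "i < n" using k by (cases k) (auto simp: idx_iff)
      have "res mu_X1 s1 s2 k \<omega> = g1 * X s1 s2 i \<omega> + 0 + 1 * \<omega> (0, i)" for \<omega>
        using k unfolding k_eq by (simp add: res_def mu_X1_def out_apply mean_def sigX1_def)
      then show ?thesis using second_moment_X(3,4)[OF s i, of g1 0] by (simp add: E_def k_eq)
    next
      case False
      have "mean s1 s2 (rx 1 n (out s1 s2 \<omega>)) k = mean s1 s2 (sigY2 g2 f2 n s2 \<omega>) k" for \<omega>
        using False by (simp add: mean_def)
      then have "res mu_X1 s1 s2 k \<omega> = 0 + 1 * \<omega> k" for \<omega>
        using False k by (simp add: res_def mu_X1_def out_apply)
      then show ?thesis using second_moment_const_noise[OF k, of 0 1] False by (simp add: E_def)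
    qed
    show "(\<Sum>s1<M1. \<Sum>s2<M2. \<Sum>i<n. E s1 s2 (0, i)) \<le> real M1 * real M2 * (n * w)"
    proof -
      have "(\<Sum>s1<M1. \<Sum>s2<M2. \<Sum>i<n. E s1 s2 (0, i))
        = g1\<^sup>2 * (\<Sum>s1<M1. \<Sum>s2<M2. \<Sum>i<n. \<integral>\<omega>. (X s1 s2 i \<omega>)\<^sup>2 \<partial>N) + real M1 * real M2 * (n * sg\<^sup>2)"
        by (simp add: E_def sum.distrib sum_distrib_left mult.assoc)
      also have "\<dots> \<le> g1\<^sup>2 * (real M1 * real M2 * (n * P1)) + real M1 * real M2 * (n * sg\<^sup>2)"
        by (intro add_right_mono mult_left_mono X_power) simp
      finally show ?thesis by (simp add: w_def algebra_simps)
    qed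
  qed (use v err ref_X1_decode[of v] ref_X1_mass[of v] in \<open>auto simp: E_def\<close>)
  also have "n * (ln (v 0 / sg) - 1 / 2) + (n * w) / (2 * (v 0)\<^sup>2) = n / 2 * ln (w / sg\<^sup>2)"
    using matched_block[OF w, of n] by (simp add: v_def)
  also have "w / sg\<^sup>2 = 1 + g1\<^sup>2 * P1 / sg\<^sup>2" using sg by (simp add: w_def add_divide_distrib)
  finally show ?thesis using sg by (simp add: v_def)
qed

lemma uplink_bound: "(1 - eps) * ln M2 \<le> n / 2 * ln (1 + g2\<^sup>2 * p / sg\<^sup>2) + ln 2"
proof -
  define w where "w = sg\<^sup>2 + g2\<^sup>2 * p"
  have w: "0 < w" using sg p unfolding w_def by (intro add_pos_nonneg) auto
  define v where "v c = (if c = 1 then sqrt w else sg)" for c :: nat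
  have v: "0 < v c" for c using w sg by (simp add: v_def)
  define E where "E s1 s2 k = (if fst k = 1 then (g2 * f2 s2 (snd k))\<^sup>2 + sg\<^sup>2 else sg\<^sup>2)" for s1 s2 :: nat and k :: "nat \<times> nat"
  have "(1 - eps) * ln M2 \<le> (n * (ln (v 0 / sg) - 1 / 2) + (n * sg\<^sup>2) / (2 * (v 0)\<^sup>2))
     + (n * (ln (v 1 / sg) - 1 / 2) + (n * w) / (2 * (v 1)\<^sup>2))
     + (m * (ln (v 2 / sg) - 1 / 2) + (m * sg\<^sup>2) / (2 * (v 2)\<^sup>2)) + ln 2"
  proof (rule gaussian_converse_blocks[where mu=mu_Y2 and E=E])
    show "1 \<le> real M2" using M2 by simp
    show "(\<lambda>y. mu_Y2 s1 s2 y k) \<in> borel_measurable (lebesgue_prod idx)" if "s1 < M1" "k \<in> idx" for s1 s2 k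
      using that by (rule mu_measurable)
    show "integrable N (\<lambda>\<omega>. (res mu_Y2 s1 s2 k \<omega>)\<^sup>2) \<and> (\<integral>\<omega>. (res mu_Y2 s1 s2 k \<omega>)\<^sup>2 \<partial>N) = E s1 s2 k"
      if s: "s1 < M1" "s2 < M2" and k: "k \<in> idx" for s1 s2 k
    proof (cases "fst k = 1")
      case True
      have "res mu_Y2 s1 s2 k \<omega> = g2 * f2 s2 (snd k) + 1 * \<omega> k" for \<omega>
        using k True by (simp add: res_def mu_Y2_def out_apply mean_def)
      then show ?thesis using second_moment_const_noise[OF k, of "g2 * f2 s2 (snd k)" 1] True by (simp add: E_def)
    next
      case False
      have "mean s1 s2 (rx 1 n (out s1 s2 \<omega>)) k = mean s1 s2 (sigY2 g2 f2 n s2 \<omega>) k" for \<omega>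
        by (simp only: rx_out)
      then have "res mu_Y2 s1 s2 k \<omega> = 0 + 1 * \<omega> k" for \<omega>
        using False k by (simp add: res_def mu_Y2_def out_apply)
      then show ?thesis using second_moment_const_noise[OF k, of 0 1] False by (simp add: E_def)
    qed
    show "(\<Sum>s1<M1. \<Sum>s2<M2. \<Sum>i<n. E s1 s2 (1, i)) \<le> real M1 * real M2 * (n * w)"
    proof -
      have "(\<Sum>s1<M1. \<Sum>s2<M2. \<Sum>i<n. E s1 s2 (1, i))
        = real M1 * (g2\<^sup>2 * (\<Sum>s2<M2. \<Sum>i<n. (f2 s2 i)\<^sup>2)) + real M1 * real M2 * (n * sg\<^sup>2)"
        by (simp add: E_def sum.distrib sum_distrib_left power_mult_distrib algebra_simps)
      also have "\<dots> \<le> real M1 * (g2\<^sup>2 * (real M2 * real n * p)) + real M1 * real M2 * (n * sg\<^sup>2)"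
        by (intro add_right_mono mult_left_mono power_X2) auto
      finally show ?thesis by (simp add: w_def algebra_simps)
    qed
  qed (use v err ref_Y2_decode[of v] ref_Y2_mass[of v] in \<open>auto simp: E_def\<close>)
  also have "n * (ln (v 1 / sg) - 1 / 2) + (n * w) / (2 * (v 1)\<^sup>2) = n / 2 * ln (w / sg\<^sup>2)"
    using matched_block[OF w, of n] by (simp add: v_def)
  also have "w / sg\<^sup>2 = 1 + g2\<^sup>2 * p / sg\<^sup>2" using sg by (simp add: w_def add_divide_distrib)
  finally show ?thesis using sg by (simp add: v_def)
qed

text \<open>The variance is matched to W n symbols although only \<open>m\<close>, the floor of W n,
  are present. The power is then spread over too few symbols, and the excess energy is at most what
  the logarithms of the missing symbols would contribute.\<close>

lemma side_block_bound:
  fixes u q :: real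
  assumes u: "u = 1 + q / W" and q: "0 \<le> q" and W': "0 < W"
  shows "m * (ln (sqrt (sg\<^sup>2 * u) / sg) - 1 / 2) + sg\<^sup>2 * (m + n * q) / (2 * (sqrt (sg\<^sup>2 * u))\<^sup>2) \<le> W * n / 2 * ln u"
proof -
  have u1: "1 \<le> u" using q W' by (simp add: u)
  have m: "real m \<le> W * n"
    using W by (simp add: side_len_def)
  have A: "ln (sqrt (sg\<^sup>2 * u) / sg) = ln u / 2"
    using u1 sg by (simp add: ln_sqrt real_sqrt_mult)
  have B: "sg\<^sup>2 * (m + n * q) / (2 * (sqrt (sg\<^sup>2 * u))\<^sup>2) = (m + n * q) / (2 * u)"
    using u1 sg by simp
  have C: "(m + n * q) / (2 * u) = m / 2 + (W * n - m) * (1 - 1 / u) / 2"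
  proof -
    have q_eq: "q = W * (u - 1)" using W' by (simp add: u)
    show ?thesis unfolding q_eq using u1 by (simp add: field_simps)
  qed
  have D: "(W * n - m) * (1 - 1 / u) \<le> (W * n - m) * ln u"
  proof (rule mult_left_mono)
    have "ln (1 / u) \<le> 1 / u - 1" using u1 by (intro ln_le_minus_one) simp
    then show "1 - 1 / u \<le> ln u" using u1 by (simp add: ln_div)
  qed (use m in simp)
  have "m * (ln u / 2 - 1 / 2) + (m / 2 + (W * n - m) * (1 - 1 / u) / 2) \<le> m * (ln u / 2 - 1 / 2) + (m / 2 + (W * n - m) * ln u / 2)"
    using D by simp
  also have "\<dots> = W * n / 2 * ln u" by (simp add: field_simps)
  finally show ?thesis unfolding A B C .
qed

text \<open>The coefficient \<open>a\<close> is that of the linear MMSE estimate of \<open>Y\<^sub>2\<close> from \<open>gm X\<^sub>2 + Z\<^sub>1\<close>.\<close>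

lemma sum_rate_bound:
  "(1 - eps) * (ln M1 + ln M2) \<le>
     n / 2 * ln (1 + (g1\<^sup>2 * P1 + gm\<^sup>2 * p + 2 * \<bar>g1 * gm\<bar> * sqrt (P1 * p)) / sg\<^sup>2)
   + n / 2 * ln (1 + (g2\<^sup>2 * p / sg\<^sup>2) / (1 + gm\<^sup>2 * p / sg\<^sup>2))
   + (if W = 0 then 0 else W * n / 2 * ln (1 + gs\<^sup>2 * r / sg\<^sup>2 / W)) + ln 2"
proof -
  define w0 where "w0 = sg\<^sup>2 + g1\<^sup>2 * P1 + gm\<^sup>2 * p + 2 * \<bar>g1 * gm\<bar> * sqrt (P1 * p)"
  define d where "d = gm\<^sup>2 * p + sg\<^sup>2"
  define a where "a = g2 * gm * p / d"
  \<comment> \<open>Average energy of the prediction error: subtracting the estimate leaves (g2 - a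
    gm) X2 + Z2 - a Z1.\<close>
  define w1 where "w1 = (g2 - a * gm)\<^sup>2 * p + (1 + a\<^sup>2) * sg\<^sup>2"
  define q where "q = gs\<^sup>2 * r / sg\<^sup>2"
  \<comment> \<open>For \<open>W = 0\<close> division by zero gives \<open>u = 1\<close>, so the
    side-channel variance stays positive although that block is empty.\<close>
  define u where "u = 1 + q / W"
  have q: "0 \<le> q" using r by (simp add: q_def)
  have u: "1 \<le> u" using q W by (simp add: u_def)
  have w0: "0 < w0" using sg P1 p unfolding w0_def by (intro add_pos_nonneg) auto
  have "0 < 1 + a\<^sup>2" by (rule add_pos_nonneg) simp_all
  from mult_pos_pos[OF this zero_less_power[OF sg]] have w1: "0 < w1"
    unfolding w1_def by (intro add_nonneg_pos mult_nonneg_nonneg zero_le_power2 p)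
  have d: "0 < d" using sg p unfolding d_def by (intro add_nonneg_pos) auto
  \<comment> \<open>The choice of \<open>a\<close> makes the error equal to the MMSE, which is
    \<open>sg\<close> squared plus g2^2 p sg^2 / d; this produces the SNR discounted by the
    interference.\<close>
  have w1_eq: "w1 / sg\<^sup>2 = 1 + (g2\<^sup>2 * p / sg\<^sup>2) / (1 + gm\<^sup>2 * p / sg\<^sup>2)"
  proof -
    have "g2 - a * gm = g2 * sg\<^sup>2 / d"
    proof -
      have "a * gm = g2 * (gm\<^sup>2 * p) / d" by (simp add: a_def power2_eq_square)
      also have "gm\<^sup>2 * p = d - sg\<^sup>2" by (simp add: d_def)
      finally show ?thesis using d by (simp add: field_simps)
    qed
    then have "w1 = (g2 * sg\<^sup>2 / d)\<^sup>2 * p + (1 + (g2 * gm * p / d)\<^sup>2) * sg\<^sup>2"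
      by (simp add: w1_def a_def)
    also have "\<dots> = sg\<^sup>2 + g2\<^sup>2 * p * sg\<^sup>2 * (gm\<^sup>2 * p + sg\<^sup>2) / d\<^sup>2"
      by (simp add: power_mult_distrib power_divide add_divide_distrib power2_eq_square algebra_simps)
    also have "\<dots> = sg\<^sup>2 + g2\<^sup>2 * p * sg\<^sup>2 / d"
      unfolding d_def[symmetric] using d by (simp add: power2_eq_square)
    finally have "w1 / sg\<^sup>2 = 1 + g2\<^sup>2 * p / d"
      using sg by (simp add: add_divide_distrib)
    moreover have "1 + gm\<^sup>2 * p / sg\<^sup>2 = d / sg\<^sup>2"
      using sg by (simp add: d_def add_divide_distrib)
    ultimately show ?thesis using sg by simp
  qed
  define v where "v c = (if c = 0 then sqrt w0 else if c = 1 then sqrt w1 else sqrt (sg\<^sup>2 * u))" for c :: nat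
  have v: "0 < v c" for c using w0 w1 sg u by (simp add: v_def)
  define E where "E s1 s2 k = (if fst k = 0 then
        g1\<^sup>2 * (\<integral>\<omega>. (X s1 s2 (snd k) \<omega>)\<^sup>2 \<partial>N) + 2 * g1 * (gm * f2 s2 (snd k) * (\<integral>\<omega>. X s1 s2 (snd k) \<omega> \<partial>N)) + (gm * f2 s2 (snd k))\<^sup>2 + sg\<^sup>2
      else if fst k = 1 then ((g2 - a * gm) * f2 s2 (snd k))\<^sup>2 + (1 + a\<^sup>2) * sg\<^sup>2
      else (gs * f3 s2 (snd k))\<^sup>2 + sg\<^sup>2)" for s1 s2 :: nat and k :: "nat \<times> nat"
  define d2 where "d2 = (if W = 0 then 0 else sg\<^sup>2 * (m + n * q))"
  have "(1 - eps) * ln (real M1 * real M2) \<le> (n * (ln (v 0 / sg) - 1 / 2) + (n * w0) / (2 * (v 0)\<^sup>2))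
     + (n * (ln (v 1 / sg) - 1 / 2) + (n * w1) / (2 * (v 1)\<^sup>2))
     + (m * (ln (v 2 / sg) - 1 / 2) + d2 / (2 * (v 2)\<^sup>2)) + ln 2"
  proof (rule gaussian_converse_blocks[where mu="mu_sum a" and E=E])
    have "1 * 1 \<le> real M1 * real M2" using M1 M2 by (intro mult_mono) auto
    then show "1 \<le> real M1 * real M2" by simp
    show "(\<lambda>y. mu_sum a s1 s2 y k) \<in> borel_measurable (lebesgue_prod idx)" if "s1 < M1" "k \<in> idx" for s1 s2 k
      using that by (rule mu_measurable)
    show "(\<integral>\<^sup>+ y. ref (mu_sum a) v s1 s2 y \<partial>lebesgue_prod idx) \<le> 1" if "s1 < M1" "s2 < M2" for s1 s2
      by (rule ref_sum_mass[OF v that])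
    show "(\<Sum>s1<M1. \<Sum>s2<M2. \<integral>\<^sup>+ y. ref (mu_sum a) v s1 s2 y * indicator (correct s1 s2) y \<partial>lebesgue_prod idx)
        \<le> ennreal (real M1 * real M2 / (real M1 * real M2))"
      using ref_sum_decode[of v a, OF v] M1 M2 by simp
    show "integrable N (\<lambda>\<omega>. (res (mu_sum a) s1 s2 k \<omega>)\<^sup>2) \<and> (\<integral>\<omega>. (res (mu_sum a) s1 s2 k \<omega>)\<^sup>2 \<partial>N) = E s1 s2 k"
      if s: "s1 < M1" "s2 < M2" and k: "k \<in> idx" for s1 s2 k
    proof -
      obtain c i where k_eq: "k = (c, i)" by (cases k)
      consider "c = 0" "i < n" | "c = 1" "i < n" | "c = 2" "i < m"
        using k by (auto simp: idx_iff k_eq)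
      then show ?thesis
      proof cases
        case 1
        have "res (mu_sum a) s1 s2 k \<omega> = g1 * X s1 s2 i \<omega> + gm * f2 s2 i + 1 * \<omega> (0, i)" for \<omega>
          using k unfolding k_eq 1 by (simp add: res_def mu_sum_def out_apply mean_def sigX1_def)
        then show ?thesis
          using second_moment_X(3,4)[OF s 1(2), of g1 "gm * f2 s2 i"] by (simp add: E_def k_eq 1)
      next
        case 2
        have k0: "(0, i) \<in> idx" and k1: "(1, i) \<in> idx" using 2 by (auto simp: idx_iff)
        \<comment> \<open>Given \<open>s1\<close> and Y2 the BS input is known and drops out, so the
          predictor works with the interference plus Z1.\<close>
        have res: "res (mu_sum a) s1 s2 k \<omega> = (g2 - a * gm) * f2 s2 i + (- a) * \<omega> (0, i) + 1 * \<omega> (1, i)" for \<omega>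
        proof -
          have "res (mu_sum a) s1 s2 k \<omega> = out s1 s2 \<omega> (1, i) - a * (out s1 s2 \<omega> (0, i) - g1 * f1 i s1 (sigY2 g2 f2 n s2 \<omega>))"
            unfolding k_eq 2 res_def mu_sum_def rx_out fst_conv snd_conv by (simp only: simp_thms if_True)
          also have "\<dots> = (\<omega> (1, i) + g2 * f2 s2 i) - a * (\<omega> (0, i) + gm * f2 s2 i)"
            by (simp add: out_apply[OF k0] out_apply[OF k1] out_apply[OF k1[simplified]] mean_def)
          finally show ?thesis by (simp add: algebra_simps)
        qed
        have "(\<lambda>\<omega>. (g2 - a * gm) * f2 s2 i + (- a) * \<omega> (0, i)) \<in> borel_measurable N"
          using component_measurable[OF k0] by (simp add: measurable_N_iff)
        note sm = second_moment_add_noise[OF k1 this second_moment_const_noise(1)[OF k0], of 1]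
        show ?thesis
          unfolding res using sm second_moment_const_noise(2)[OF k0, of "(g2 - a * gm) * f2 s2 i" "- a"]
          by (simp add: E_def k_eq 2 algebra_simps)
      next
        case 3
        have "res (mu_sum a) s1 s2 k \<omega> = gs * f3 s2 i + 1 * \<omega> k" for \<omega>
          using k unfolding k_eq 3 by (simp add: res_def mu_sum_def out_apply mean_def)
        then show ?thesis
          using second_moment_const_noise[OF k, of "gs * f3 s2 i" 1] by (simp add: E_def k_eq 3)
      qed
    qed
    show "(\<Sum>s1<M1. \<Sum>s2<M2. \<Sum>i<n. E s1 s2 (0, i)) \<le> real M1 * real M2 * (n * w0)"
      using superposition_power by (simp add: E_def w0_def)
    show "(\<Sum>s1<M1. \<Sum>s2<M2. \<Sum>i<n. E s1 s2 (1, i)) \<le> real M1 * real M2 * (n * w1)"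
    proof -
      have "(\<Sum>s1<M1. \<Sum>s2<M2. \<Sum>i<n. E s1 s2 (1, i))
        = real M1 * ((g2 - a * gm)\<^sup>2 * (\<Sum>s2<M2. \<Sum>i<n. (f2 s2 i)\<^sup>2)) + real M1 * real M2 * (n * ((1 + a\<^sup>2) * sg\<^sup>2))"
        by (simp add: E_def sum.distrib sum_distrib_left[symmetric] power_mult_distrib distrib_left)
      also have "\<dots> \<le> real M1 * ((g2 - a * gm)\<^sup>2 * (real M2 * real n * p)) + real M1 * real M2 * (n * ((1 + a\<^sup>2) * sg\<^sup>2))"
        by (intro add_right_mono mult_left_mono power_X2) auto
      also have "\<dots> = real M1 * real M2 * (n * w1)"
        unfolding w1_def by algebra
      finally show ?thesis .
    qed
    show "(\<Sum>s1<M1. \<Sum>s2<M2. \<Sum>j<m. E s1 s2 (2, j)) \<le> real M1 * real M2 * d2"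
    proof (cases "W = 0")
      case True
      then show ?thesis by (simp add: side_len_def d2_def)
    next
      case False
      have "(\<Sum>s1<M1. \<Sum>s2<M2. \<Sum>j<m. E s1 s2 (2, j))
        = real M1 * (gs\<^sup>2 * (\<Sum>s2<M2. \<Sum>j<m. (f3 s2 j)\<^sup>2)) + real M1 * real M2 * (m * sg\<^sup>2)"
        by (simp add: E_def sum.distrib sum_distrib_left[symmetric] power_mult_distrib distrib_left)
      also have "\<dots> \<le> real M1 * (gs\<^sup>2 * (real M2 * real n * r)) + real M1 * real M2 * (m * sg\<^sup>2)"
        by (intro add_right_mono mult_left_mono power_X3) auto
      also have "\<dots> = real M1 * real M2 * d2"
        using False sg by (simp add: d2_def q_def algebra_simps)
      finally show ?thesis .
    qed
  qed (use v err in auto)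
  also have "n * (ln (v 0 / sg) - 1 / 2) + (n * w0) / (2 * (v 0)\<^sup>2) = n / 2 * ln (w0 / sg\<^sup>2)"
    using matched_block[OF w0, of n] by (simp add: v_def)
  also have "n * (ln (v 1 / sg) - 1 / 2) + (n * w1) / (2 * (v 1)\<^sup>2) = n / 2 * ln (w1 / sg\<^sup>2)"
    using matched_block[OF w1, of n] by (simp add: v_def)
  also have "w0 / sg\<^sup>2 = 1 + (g1\<^sup>2 * P1 + gm\<^sup>2 * p + 2 * \<bar>g1 * gm\<bar> * sqrt (P1 * p)) / sg\<^sup>2"
    using sg by (simp add: w0_def add_divide_distrib)
  also note w1_eq
  finally have 1: "(1 - eps) * ln (real M1 * real M2) \<le>
      n / 2 * ln (1 + (g1\<^sup>2 * P1 + gm\<^sup>2 * p + 2 * \<bar>g1 * gm\<bar> * sqrt (P1 * p)) / sg\<^sup>2)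
    + n / 2 * ln (1 + (g2\<^sup>2 * p / sg\<^sup>2) / (1 + gm\<^sup>2 * p / sg\<^sup>2))
    + (m * (ln (v 2 / sg) - 1 / 2) + d2 / (2 * (v 2)\<^sup>2)) + ln 2" .
  have side: "m * (ln (v 2 / sg) - 1 / 2) + d2 / (2 * (v 2)\<^sup>2)
      \<le> (if W = 0 then 0 else W * n / 2 * ln (1 + gs\<^sup>2 * r / sg\<^sup>2 / W))"
  proof (cases "W = 0")
    case True
    then show ?thesis by (simp add: side_len_def d2_def)
  next
    case False
    then show ?thesis
      using side_block_bound[OF u_def q] W by (simp add: v_def d2_def u_def q_def)
  qed
  have "ln (real M1 * real M2) = ln M1 + ln M2" using M1 M2 by (simp add: ln_mult)
  from order_trans[OF 1[unfolded this] add_right_mono[OF add_left_mono[OF side]]] show ?thesis .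
qed

end

end

section \<open>The outer bound\<close>

text \<open>The power of M1 is divided as this code actually spends it, so \<open>lam\<close>
  depends on the code. The term 2 Wm / n is the \<open>ln 2\<close> per block after conversion to
  bits per second.\<close>

lemma code_bounds:
  fixes Wm W P1 P2 g1 g2 gm gs sg eps :: real
  defines "S1 \<equiv> g1\<^sup>2 * P1 / sg\<^sup>2" and "S2 \<equiv> g2\<^sup>2 * P2 / sg\<^sup>2"
    and "I \<equiv> gm\<^sup>2 * P2 / sg\<^sup>2" and "Ss \<equiv> gs\<^sup>2 * P2 / sg\<^sup>2"
  assumes Wm: "0 < Wm" and W: "0 \<le> W" and P1: "0 \<le> P1" and P2: "0 \<le> P2" and sg: "0 < sg"
    and eps: "eps \<le> 1"
    and code: "good_code W P1 P2 g1 g2 gm gs sg n M1 M2 f1 f2 f3 dec1 dec2 eps"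
  shows "\<exists>lam\<in>{0..1}.
      (1 - eps) * (2 * Wm * log 2 M1 / n) \<le> Ccap Wm S1 + 2 * Wm / n \<and>
      (1 - eps) * (2 * Wm * log 2 M2 / n) \<le> Ccap Wm ((1 - lam) * S2) + 2 * Wm / n \<and>
      (1 - eps) * (2 * Wm * log 2 M1 / n + 2 * Wm * log 2 M2 / n) \<le>
         Ccap Wm ((1 - lam) * S2 / (1 + (1 - lam) * I)) + side_term Wm W (lam * Ss)
       + Ccap Wm (S1 + (1 - lam) * I + 2 * sqrt ((1 - lam) * S1 * I)) + 2 * Wm / n"
proof -
  let ?m = "side_len W n"
  have n: "0 < n" and M1: "0 < M1" and M2: "0 < M2"
    using code by (auto simp: good_code_def)
  interpret network_code W g1 g2 gm gs sg n M1 M2 f1 f2 f3 dec1 dec2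
    using code sg by unfold_locales (auto simp: good_code_def)
  have power_X1: "(\<Sum>s1<M1. \<Sum>s2<M2. \<integral>\<^sup>+ \<omega>. ennreal (\<Sum>i<n. (sigX1 f1 g2 f2 n s1 s2 \<omega> i)\<^sup>2) \<partial>noise n ?m sg)
       \<le> ennreal (real M1 * real M2 * real n * P1)"
    and power_M1: "(\<Sum>s2<M2. (\<Sum>i<n. (f2 s2 i)\<^sup>2) + (\<Sum>j<?m. (f3 s2 j)\<^sup>2)) \<le> real M2 * real n * P2"
    and err: "(\<Sum>s1<M1. \<Sum>s2<M2. measure (noise n ?m sg)
          (err_event g1 g2 gm gs sg W n f1 f2 f3 dec1 dec2 s1 s2)) \<le> eps * real M1 * real M2"
    using code by (auto simp: good_code_def)
  define A where "A = (\<Sum>s2<M2. \<Sum>i<n. (f2 s2 i)\<^sup>2)"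
  define B where "B = (\<Sum>s2<M2. \<Sum>j<?m. (f3 s2 j)\<^sup>2)"
  define p where "p = A / (real M2 * real n)"
  \<comment> \<open>If \<open>P2 = 0\<close> then also \<open>p = 0\<close>, and the value 0 keeps
    \<open>(1 - lam) * P2 = p\<close> valid.\<close>
  define lam where "lam = (if P2 = 0 then 0 else 1 - p / P2)"
  have nM: "0 < real M2 * real n" using n M2 by simp
  have A0: "0 \<le> A" and B0: "0 \<le> B" unfolding A_def B_def by (auto intro!: sum_nonneg)
  have AB: "A + B \<le> real M2 * real n * P2"
    using power_M1 by (simp only: A_def B_def sum.distrib)
  have p0: "0 \<le> p" using A0 by (simp add: p_def)
  have p_le: "p \<le> P2" using AB B0 nM by (simp add: p_def divide_le_eq mult_ac)
  have A_eq: "A = real M2 * real n * p" using n M2 by (simp add: p_def)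
  have p_eq: "(1 - lam) * P2 = p" using p0 p_le by (auto simp: lam_def)
  have r: "lam * P2 = P2 - p" using p_eq by (simp add: algebra_simps)
  have B_le: "B \<le> real M2 * real n * (lam * P2)"
    using AB unfolding A_eq r by (simp add: algebra_simps)
  have lam: "lam \<in> {0..1}"
    using p0 p_le P2 by (auto simp: lam_def divide_le_eq)
  have lamP: "0 \<le> lam * P2" using lam P2 by simp
  note bounds = P1 p0 lamP W power_X1 A_eq[unfolded A_def, THEN eq_refl] B_le[unfolded B_def] err
  \<comment> \<open>Multiplication by 2 Wm / (n ln 2) turns nats per block into bits per
    second.\<close>
  have conv: "(1 - eps) * (2 * Wm * x / n) \<le> Wm * L / ln 2 + 2 * Wm / n"
    if le: "(1 - eps) * (x * ln 2) \<le> n / 2 * L + ln 2" for x L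
  proof -
    have "(1 - eps) * (2 * Wm * x / n) = (2 * Wm / (n * ln 2)) * ((1 - eps) * (x * ln 2))"
      using n by (simp add: field_simps)
    also have "\<dots> \<le> (2 * Wm / (n * ln 2)) * (n / 2 * L + ln 2)"
      using Wm by (intro mult_left_mono le) simp
    also have "\<dots> = Wm * L / ln 2 + 2 * Wm / n"
      using n by (simp add: field_simps)
    finally show ?thesis .
  qed
  have c1: "Wm * ln (1 + x) / ln 2 = Ccap Wm x" for x
    by (simp add: Ccap_def log_def)
  have ln_log: "ln x = log 2 x * ln 2" for x :: real
    by (simp add: log_def)
  have "(1 - eps) * (2 * Wm * log 2 M1 / n) \<le> Ccap Wm S1 + 2 * Wm / n"
    using conv[of "log 2 M1" "ln (1 + S1)"] downlink_bound[OF bounds]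
    by (simp add: c1 ln_log[symmetric] S1_def)
  moreover have "(1 - eps) * (2 * Wm * log 2 M2 / n) \<le> Ccap Wm ((1 - lam) * S2) + 2 * Wm / n"
  proof -
    have e: "(1 - lam) * S2 = g2\<^sup>2 * p / sg\<^sup>2" by (simp add: S2_def p_eq[symmetric])
    show ?thesis
      using conv[of "log 2 M2" "ln (1 + (1 - lam) * S2)"] uplink_bound[OF bounds]
      by (simp add: c1 ln_log[symmetric] e)
  qed
  moreover have "(1 - eps) * (2 * Wm * log 2 M1 / n + 2 * Wm * log 2 M2 / n) \<le>
         Ccap Wm ((1 - lam) * S2 / (1 + (1 - lam) * I)) + side_term Wm W (lam * Ss)
       + Ccap Wm (S1 + (1 - lam) * I + 2 * sqrt ((1 - lam) * S1 * I)) + 2 * Wm / n"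
  proof -
    let ?L0 = "ln (1 + (g1\<^sup>2 * P1 + gm\<^sup>2 * p + 2 * \<bar>g1 * gm\<bar> * sqrt (P1 * p)) / sg\<^sup>2)"
    let ?L1 = "ln (1 + (g2\<^sup>2 * p / sg\<^sup>2) / (1 + gm\<^sup>2 * p / sg\<^sup>2))"
    let ?L2 = "if W = 0 then 0 else W * ln (1 + gs\<^sup>2 * (lam * P2) / sg\<^sup>2 / W)"
    have e2: "(1 - lam) * S2 = g2\<^sup>2 * p / sg\<^sup>2" and eI: "(1 - lam) * I = gm\<^sup>2 * p / sg\<^sup>2"
      and es: "lam * Ss = gs\<^sup>2 * (lam * P2) / sg\<^sup>2"
      by (simp_all add: S2_def I_def Ss_def p_eq[symmetric])
    \<comment> \<open>Only the square of the gain product enters, so the root returns its absolute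
      value, whatever the signs of the gains.\<close>
    have "(1 - lam) * S1 * I = (g1 * gm / sg\<^sup>2)\<^sup>2 * (P1 * p)"
      by (simp add: S1_def I_def p_eq[symmetric] power_mult_distrib power_divide power2_eq_square)
    then have "sqrt ((1 - lam) * S1 * I) = \<bar>g1 * gm\<bar> / sg\<^sup>2 * sqrt (P1 * p)"
      by (simp add: real_sqrt_mult abs_divide)
    then have e0: "S1 + (1 - lam) * I + 2 * sqrt ((1 - lam) * S1 * I)
        = (g1\<^sup>2 * P1 + gm\<^sup>2 * p + 2 * \<bar>g1 * gm\<bar> * sqrt (P1 * p)) / sg\<^sup>2"
      by (simp only: eI S1_def) (simp add: add_divide_distrib)
    have "(1 - eps) * ((log 2 M1 + log 2 M2) * ln 2) \<le> n / 2 * (?L0 + ?L1 + ?L2) + ln 2"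
    proof -
      have "(log 2 M1 + log 2 M2) * ln 2 = ln M1 + ln M2" by (simp add: log_def field_simps)
      moreover have "n / 2 * (?L0 + ?L1 + ?L2) = n / 2 * ?L0 + n / 2 * ?L1
          + (if W = 0 then 0 else W * n / 2 * ln (1 + gs\<^sup>2 * (lam * P2) / sg\<^sup>2 / W))"
        by (simp add: distrib_left)
      ultimately show ?thesis using sum_rate_bound[OF bounds] by (simp only:)
    qed
    from conv[OF this]
    have "(1 - eps) * (2 * Wm * (log 2 M1 + log 2 M2) / n) \<le> Wm * (?L0 + ?L1 + ?L2) / ln 2 + 2 * Wm / n" .
    also have "2 * Wm * (log 2 M1 + log 2 M2) / n = 2 * Wm * log 2 M1 / n + 2 * Wm * log 2 M2 / n"
      by (simp add: distrib_left add_divide_distrib)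
    also have "Wm * (?L0 + ?L1 + ?L2) / ln 2 = Wm * ?L0 / ln 2 + Wm * ?L1 / ln 2 + Wm * ?L2 / ln 2"
      by (simp only: distrib_left add_divide_distrib)
    also have "Wm * ?L2 / ln 2 = side_term Wm W (lam * Ss)"
      by (simp add: side_term_def Ccap_def log_def es)
    finally show ?thesis unfolding c1 e0 unfolding e2 eI by (simp only: add_ac)
  qed
  ultimately show ?thesis using lam by blast
qed

text \<open>Codes with vanishing \<open>eps\<close> come with their own power splits; a convergent
  subsequence supplies one split, and all bounds are continuous in it.\<close>

theorem theorem1:
  fixes Wm W P1 P2 g1 g2 gm gs sg R1 R2 :: real
  assumes "0 < Wm" and "0 \<le> W" and "0 \<le> P1" and "0 \<le> P2" and "0 < sg"
    and "(R1, R2) \<in> capacity_region Wm W P1 P2 g1 g2 gm gs sg"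
  shows "\<exists>lam\<in>{0..1::real}.
     (let SNR1 = g1\<^sup>2 * P1 / sg\<^sup>2; SNR2 = g2\<^sup>2 * P2 / sg\<^sup>2;
          INR = gm\<^sup>2 * P2 / sg\<^sup>2; SNRs = gs\<^sup>2 * P2 / sg\<^sup>2 in
      R1 \<le> Ccap Wm SNR1 \<and>
      R2 \<le> Ccap Wm ((1 - lam) * SNR2) \<and>
      R1 + R2 \<le> Ccap Wm ((1 - lam) * SNR2 / (1 + (1 - lam) * INR))
               + side_term Wm W (lam * SNRs)
               + Ccap Wm (SNR1 + (1 - lam) * INR + 2 * sqrt ((1 - lam) * SNR1 * INR)))"
proof -
  define S1 where "S1 = g1\<^sup>2 * P1 / sg\<^sup>2"
  define S2 where "S2 = g2\<^sup>2 * P2 / sg\<^sup>2"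
  define I where "I = gm\<^sup>2 * P2 / sg\<^sup>2"
  define Ss where "Ss = gs\<^sup>2 * P2 / sg\<^sup>2"
  define F where "F lam = Ccap Wm ((1 - lam) * S2 / (1 + (1 - lam) * I)) + side_term Wm W (lam * Ss)
       + Ccap Wm (S1 + (1 - lam) * I + 2 * sqrt ((1 - lam) * S1 * I))" for lam
  have nonneg: "0 \<le> S1" "0 \<le> S2" "0 \<le> I" "0 \<le> Ss"
    using assms(3,4) by (simp_all add: S1_def S2_def I_def Ss_def)
  \<comment> \<open>One sequence serves as error bound, as rate slack and, because block lengths of
    at least \<open>Suc k\<close> are requested, as a bound on 1/n.\<close>
  define e where "e k = 1 / real (Suc k)" for k
  have e: "0 < e k" "e k \<le> 1" for k by (simp_all add: e_def)
  have "\<exists>lam\<in>{0..1}. (1 - e k) * (R1 - e k) \<le> Ccap Wm S1 + 2 * Wm * e k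
      \<and> (1 - e k) * (R2 - e k) \<le> Ccap Wm ((1 - lam) * S2) + 2 * Wm * e k
      \<and> (1 - e k) * (R1 - e k + (R2 - e k)) \<le> F lam + 2 * Wm * e k" for k
  proof -
    obtain n M1 M2 f1 f2 f3 dec1 dec2 where nk: "Suc k \<le> n"
      and code: "good_code W P1 P2 g1 g2 gm gs sg n M1 M2 f1 f2 f3 dec1 dec2 (e k)"
      and R: "R1 - e k \<le> 2 * Wm * log 2 (real M1) / real n" "R2 - e k \<le> 2 * Wm * log 2 (real M2) / real n"
      using assms(6) e(1)[of k] unfolding capacity_region_def by blast
    have ne: "2 * Wm / n \<le> 2 * Wm * e k"
      using nk assms(1) unfolding e_def times_divide_eq_right mult_1_right
      by (intro divide_left_mono) auto
    have ek: "0 \<le> 1 - e k" using e(2)[of k] by simp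
    from code_bounds[OF assms(1-5) e(2) code] obtain lam where lam: "lam \<in> {0..1}"
      and b: "(1 - e k) * (2 * Wm * log 2 M1 / n) \<le> Ccap Wm S1 + 2 * Wm / n"
        "(1 - e k) * (2 * Wm * log 2 M2 / n) \<le> Ccap Wm ((1 - lam) * S2) + 2 * Wm / n"
        "(1 - e k) * (2 * Wm * log 2 M1 / n + 2 * Wm * log 2 M2 / n) \<le> F lam + 2 * Wm / n"
      unfolding F_def S1_def S2_def I_def Ss_def by blast
    from mult_left_mono[OF R(1) ek] mult_left_mono[OF R(2) ek] mult_left_mono[OF add_mono[OF R] ek] b ne lam
    show ?thesis by (intro bexI[of _ lam] conjI) linarith+
  qed
  then obtain lam where lam: "\<And>k. lam k \<in> {0..1}"
    and b1: "\<And>k. (1 - e k) * (R1 - e k) \<le> Ccap Wm S1 + 2 * Wm * e k"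
    and b2: "\<And>k. (1 - e k) * (R2 - e k) \<le> Ccap Wm ((1 - lam k) * S2) + 2 * Wm * e k"
    and b3: "\<And>k. (1 - e k) * (R1 - e k + (R2 - e k)) \<le> F (lam k) + 2 * Wm * e k"
    by metis
  have "compact {0..1::real}" by (rule compact_Icc)
  then obtain l r where l: "l \<in> {0..1}" and r: "strict_mono r" and lim: "(lam \<circ> r) \<longlonglongrightarrow> l"
    using lam unfolding compact_def by metis
  have "e \<longlonglongrightarrow> 0" unfolding e_def by (rule LIMSEQ_Suc[OF lim_1_over_n])
  then have e0: "(\<lambda>k. e (r k)) \<longlonglongrightarrow> 0"
    using LIMSEQ_subseq_LIMSEQ[OF _ r] by (auto simp: comp_def)
  have lim': "(\<lambda>k. lam (r k)) \<longlonglongrightarrow> l" using lim by (simp add: comp_def)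
  have lhs: "(\<lambda>k. (1 - e (r k)) * (x - e (r k))) \<longlonglongrightarrow> x" for x
  proof -
    have "(\<lambda>k. (1 - e (r k)) * (x - e (r k))) \<longlonglongrightarrow> (1 - 0) * (x - 0)" by (intro tendsto_intros e0)
    then show ?thesis by simp
  qed
  have lhs2: "(\<lambda>k. (1 - e (r k)) * (R1 - e (r k) + (R2 - e (r k)))) \<longlonglongrightarrow> R1 + R2"
  proof -
    have "(\<lambda>k. (1 - e (r k)) * (R1 - e (r k) + (R2 - e (r k)))) \<longlonglongrightarrow> (1 - 0) * (R1 - 0 + (R2 - 0))"
      by (intro tendsto_intros e0)
    then show ?thesis by simp
  qed
  have rhs: "(\<lambda>k. f k + 2 * Wm * e (r k)) \<longlonglongrightarrow> y" if "f \<longlonglongrightarrow> y" for f y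
  proof -
    have "(\<lambda>k. f k + 2 * Wm * e (r k)) \<longlonglongrightarrow> y + 2 * Wm * 0" by (intro tendsto_intros e0 that)
    then show ?thesis by simp
  qed
  \<comment> \<open>The logarithm is continuous at the limit because its argument there is at least
    1.\<close>
  have cap: "(\<lambda>k. Ccap Wm (f k)) \<longlonglongrightarrow> Ccap Wm y" if "f \<longlonglongrightarrow> y" "0 \<le> y" for f y
    unfolding Ccap_def using that by (intro tendsto_intros) auto
  have l': "0 \<le> l" "0 \<le> 1 - l" using l by auto
  have dI: "0 < 1 + (1 - l) * I" using l' nonneg by (intro add_pos_nonneg) auto
  have side: "(\<lambda>k. side_term Wm W (lam (r k) * Ss)) \<longlonglongrightarrow> side_term Wm W (l * Ss)"
  proof (cases "W = 0")
    case False
    have "(\<lambda>k. W * Ccap Wm (lam (r k) * Ss / W)) \<longlonglongrightarrow> W * Ccap Wm (l * Ss / W)"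
      using assms(2) False l' nonneg by (intro tendsto_intros cap lim') auto
    with False show ?thesis by (simp add: side_term_def)
  qed (simp add: side_term_def)
  have limF: "(\<lambda>k. F (lam (r k))) \<longlonglongrightarrow> F l"
    unfolding F_def using l' nonneg dI
    by (intro tendsto_intros cap side lim') (auto intro!: add_nonneg_nonneg mult_nonneg_nonneg divide_nonneg_pos)
  have "R1 \<le> Ccap Wm S1"
    by (rule LIMSEQ_le[OF lhs rhs[OF tendsto_const]]) (use b1 in auto)
  moreover have "R2 \<le> Ccap Wm ((1 - l) * S2)"
  proof (rule LIMSEQ_le[OF lhs rhs])
    show "(\<lambda>k. Ccap Wm ((1 - lam (r k)) * S2)) \<longlonglongrightarrow> Ccap Wm ((1 - l) * S2)"
      using l' nonneg by (intro cap tendsto_intros lim') auto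
  qed (use b2 in auto)
  moreover have "R1 + R2 \<le> F l"
    by (rule LIMSEQ_le[OF lhs2 rhs[OF limF]]) (use b3 in auto)
  ultimately show ?thesis
    using l unfolding Let_def F_def S1_def S2_def I_def Ss_def by blast
qed

end
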